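(* Let $(X,J)$ be a Markov modulated Brownian motion with $\mu_i\in\mathbb{R}$ and $\sigma_i^2>0$ for all $i\in E$, as in the context. Let $p_0,p_1,x_1$ be positive numbers and let the killing intensity be, for all $i\in E$, $$\omega(i,x)=\omega(x)=p_0+(p_1-p_0)\mathbf{1}_{\{x>x_1\}}.$$ Then (with $x>y$) for $x\le x_1$, $$\mathcal{W}^{(\omega)}(x,y)=\mathbf{W}^{(p_0)}(x-y),$$ and for $x>x_1$, $$\mathcal{W}^{(\omega)}(x,y)=\Big(e^{-\mathbf{\Lambda}^+_{p_1}(x-x_1)}\big(\mathbf{\Lambda}^+_{p_1}+\mathbf{\Lambda}^-_{p_1}\big)^{-1}\mathbf{\Lambda}^-_{p_1}+e^{\mathbf{\Lambda}^-_{p_1}(x-x_1)}\big(\mathbf{\Lambda}^+_{p_1}+\mathbf{\Lambda}^-_{p_1}\big)^{-1}\mathbf{\Lambda}^+_{p_1}\Big)\mathbf{W}^{(p_0)}(x_1-y)-\mathbf{W}^{(p_1)}(x-x_1)\,\Delta_{\boldsymbol{\sigma}^2/2}\,\mathbf{W}^{(p_0)\prime}(x_1-y).$$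
   Context: $E=\{1,\dots,N\}$; $J$ is an irreducible continuous-time Markov chain on $E$ with transition rate matrix $\mathbf{Q}$. In a Markov modulated Brownian motion $(X,J)$, $X$ evolves, while $J=i$, as a Brownian motion with drift $\mu_i$ and variance $\sigma_i^2>0$ (no jumps at transitions of $J$). $\Delta_{\boldsymbol v}$ denotes the diagonal matrix with the vector $\boldsymbol v$ on the diagonal, operations on vectors being entrywise (e.g. $\Delta_{\boldsymbol{\sigma}^2/2}=\mathrm{diag}(\sigma_i^2/2)$). The matrix Laplace exponent is $\mathbf{F}(s)=\tfrac12\Delta_{\boldsymbol{\sigma}}^2s^2+\Delta_{\boldsymbol{\mu}}s+\mathbf{Q}$. For $q\ge0$, $\mathbf{W}^{(q)}:[0,\infty)\to\mathbb{R}^{N\times N}$ is the continuous matrix function with $\int_0^\infty e^{-\alpha x}\mathbf{W}^{(q)}(x)dx=(\mathbf{F}(\alpha)-q\mathbf{I})^{-1}$ for all large enough $\alpha$; $\mathbf{W}^{(q)}(x)=\mathbf 0$ for $x<0$; $\mathbf{W}=\mathbf{W}^{(0)}$; a prime denotes the derivative. For $q>0$, $\mathbf{\Lambda}^\pm_q$ are the (unique) right solutions of $\Delta_{\boldsymbol{\sigma}^2/2}(\mathbf{\Lambda}^\pm_q)^2\mp\Delta_{\boldsymbol{\mu}}\mathbf{\Lambda}^\pm_q+(\mathbf{Q}-q\mathbf{I})=\mathbf 0$, namely the transition rate matrices of the first-passage chains of $(X,J)$ and $(-X,J)$ killed at rate $q$: started at $X_0=0$, with $T^{\pm}_x=\inf\{t>0:\pm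 X_t\ge x\}$, $\mathbb{E}[e^{-qT^\pm_x},T_x^{\pm}<\infty,J_{T^\pm_x}=j|J_0=i]=(e^{\mathbf{\Lambda}^\pm_qx})_{ij}$, $x\ge0$. One has $\mathbf{W}^{(q)}(x)=(e^{-\mathbf{\Lambda}^+_qx}-e^{\mathbf{\Lambda}^-_qx})\boldsymbol{\Xi}_q$ for $x\ge0$, where $\boldsymbol{\Xi}_q^{-1}=-\tfrac12\Delta_{\boldsymbol\sigma}^2(\mathbf{\Lambda}^+_q+\mathbf{\Lambda}^-_q)$. $\mathcal{W}^{(\omega)}(x,y)$ is the unique solution of $$\mathcal{W}^{(\omega)}(x,y)=\mathbf{W}(x-y)+\int_y^x\omega(z)\,\mathbf{W}(x-z)\mathcal{W}^{(\omega)}(z,y)dz.$$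
   Formalization: In the formula for x > x_1 the last term is taken with a plus sign instead of the printed minus (which fails already for N=1, Q=0, μ=0, σ²=2, p_0=p_1=1), and that formula is stated for y ≤ x_1 only, since for x_1 < y < x its right-hand side vanishes. *)

theory Defs
  imports "HOL-Probability.Probability"
begin

section \<open>Matrices\<close>

definition diag_mat :: "real^'n \<Rightarrow> real^'n^'n" where
  "diag_mat v = (\<chi> i j. if i = j then v $ i else 0)"

definition mat_pow :: "real^'n^'n \<Rightarrow> nat \<Rightarrow> real^'n^'n" where
  "mat_pow A k = (((**) A) ^^ k) (mat 1)"

text \<open>Products on \<^typ>\<open>real^'n^'n\<close> are taken with \<open>**\<close>, so the library function \<open>exp\<close> is not
  available for matrices.\<close>

definition mat_exp :: "real^'n^'n \<Rightarrow> real^'n^'n" where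
  "mat_exp A = (\<Sum>k. (1 / fact k) *\<^sub>R mat_pow A k)"


section \<open>The modulating chain\<close>

definition transition_rate_matrix :: "real^'n^'n \<Rightarrow> bool" where
  "transition_rate_matrix Q \<longleftrightarrow>
     (\<forall>i j. i \<noteq> j \<longrightarrow> 0 \<le> Q $ i $ j) \<and> (\<forall>i. (\<Sum>j\<in>UNIV. Q $ i $ j) = 0)"

definition irreducible_rates :: "real^'n^'n \<Rightarrow> bool" where
  "irreducible_rates Q \<longleftrightarrow> (\<forall>i j. (i, j) \<in> {(k, l). k \<noteq> l \<and> 0 < Q $ k $ l}\<^sup>*)"

text \<open>\<open>J\<close> is a chain started in \<open>i\<close>: right-continuous step paths and the
  finite-dimensional distributions given by the semigroup \<open>exp (t Q)\<close>. Time is \<open>[0,\<infinity>)\<close>; values at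
  negative times are irrelevant.\<close>

definition markov_chain_from ::
  "real^'n^'n \<Rightarrow> 'n \<Rightarrow> 'w measure \<Rightarrow> (real \<Rightarrow> 'w \<Rightarrow> 'n::finite) \<Rightarrow> bool" where
  "markov_chain_from Q i M J \<longleftrightarrow>
     (\<forall>t\<ge>0. J t \<in> measurable M (count_space UNIV)) \<and>
     (\<forall>\<omega>\<in>space M. \<forall>t\<ge>0.
        (\<forall>\<^sub>F s in at_right t. J s \<omega> = J t \<omega>) \<and>
        (0 < t \<longrightarrow> (\<exists>k. \<forall>\<^sub>F s in at_left t. J s \<omega> = k))) \<and>
     (\<forall>(n::nat) (t::nat \<Rightarrow> real) (k::nat \<Rightarrow> 'n). t 0 = 0 \<and> mono t \<longrightarrow>
        measure M {\<omega>\<in>space M. \<forall>m\<le>n. J (t m) \<omega> = k m} =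
          (if k 0 = i then 1 else 0) *
          (\<Prod>m<n. mat_exp ((t (Suc m) - t m) *\<^sub>R Q) $ k m $ k (Suc m)))"


section \<open>Markov modulated Brownian motion\<close>

definition standard_brownian_motion :: "'w measure \<Rightarrow> (real \<Rightarrow> 'w \<Rightarrow> real) \<Rightarrow> bool" where
  "standard_brownian_motion M B \<longleftrightarrow>
     (\<forall>t\<ge>0. B t \<in> borel_measurable M) \<and>
     (AE \<omega> in M. B 0 \<omega> = 0) \<and>
     (AE \<omega> in M. continuous_on {0..} (\<lambda>t. B t \<omega>)) \<and>
     (\<forall>s t. 0 \<le> s \<and> s < t \<longrightarrow>
        distributed M lborel (\<lambda>\<omega>. B t \<omega> - B s \<omega>) (normal_density 0 (sqrt (t - s)))) \<and>
     (\<forall>(n::nat) (t::nat \<Rightarrow> real). 0 \<le> t 0 \<and> strict_mono t \<longrightarrow>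
        prob_space.indep_vars M (\<lambda>_. borel) (\<lambda>m \<omega>. B (t (Suc m)) \<omega> - B (t m) \<omega>) {..<n})"

definition process_events ::
  "'w measure \<Rightarrow> 'v measure \<Rightarrow> (real \<Rightarrow> 'w \<Rightarrow> 'v) \<Rightarrow> 'w set set" where
  "process_events M S Y =
     sigma_sets (space M) {Y t -` A \<inter> space M | t A. 0 \<le> t \<and> A \<in> sets S}"

definition occupation_time :: "(real \<Rightarrow> 'w \<Rightarrow> 'n) \<Rightarrow> 'n \<Rightarrow> real \<Rightarrow> 'w \<Rightarrow> real" where
  "occupation_time J i t \<omega> = measure lborel {u \<in> {0..t}. J u \<omega> = i}"

text \<open>The pair \<open>(X, J)\<close> started from \<open>(0, i)\<close>. While \<open>J\<close> is in state \<open>k\<close>, \<open>X\<close> moves along its own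
  Brownian motion with drift \<open>\<mu> $ k\<close> and variance \<open>(\<sigma> $ k)\<^sup>2\<close>, run on the clock that measures the time
  spent in \<open>k\<close>; these Brownian motions and \<open>J\<close> are independent. Since the clocks are continuous, \<open>X\<close>
  does not jump at the transitions of \<open>J\<close>. In the index type of \<open>indep_sets\<close>,
  \<open>None\<close> stands for \<open>J\<close> and \<open>Some k\<close> for the \<open>k\<close>-th Brownian motion.\<close>

definition mmbm_from ::
  "real^'n^'n \<Rightarrow> real^'n \<Rightarrow> real^'n \<Rightarrow> 'n \<Rightarrow> 'w measure \<Rightarrow>
     (real \<Rightarrow> 'w \<Rightarrow> real) \<Rightarrow> (real \<Rightarrow> 'w \<Rightarrow> 'n::finite) \<Rightarrow> bool" where
  "mmbm_from Q \<mu> \<sigma> i M X J \<longleftrightarrow>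
     prob_space M \<and>
     markov_chain_from Q i M J \<and>
     (\<forall>t\<ge>0. X t \<in> borel_measurable M) \<and>
     (\<exists>B :: 'n \<Rightarrow> real \<Rightarrow> 'w \<Rightarrow> real.
        (\<forall>k. standard_brownian_motion M (B k)) \<and>
        prob_space.indep_sets M
          (case_option (process_events M (count_space UNIV) J) (\<lambda>k. process_events M borel (B k)))
          UNIV \<and>
        (AE \<omega> in M. \<forall>t\<ge>0.
           X t \<omega> = (\<Sum>k\<in>UNIV. \<mu> $ k * occupation_time J k t \<omega>
                              + \<sigma> $ k * B k (occupation_time J k t \<omega>) \<omega>)))"

text \<open>\<open>P i\<close> is the law under which the chain starts in \<open>i\<close>.\<close>

definition mmbm ::
  "real^'n^'n \<Rightarrow> real^'n \<Rightarrow> real^'n \<Rightarrow> ('n \<Rightarrow> 'w measure) \<Rightarrow>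
     (real \<Rightarrow> 'w \<Rightarrow> real) \<Rightarrow> (real \<Rightarrow> 'w \<Rightarrow> 'n::finite) \<Rightarrow> bool" where
  "mmbm Q \<mu> \<sigma> P X J \<longleftrightarrow>
     transition_rate_matrix Q \<and> irreducible_rates Q \<and> (\<forall>i. mmbm_from Q \<mu> \<sigma> i (P i) X J)"

definition matrix_laplace_exponent ::
  "real^'n^'n \<Rightarrow> real^'n \<Rightarrow> real^'n \<Rightarrow> real \<Rightarrow> real^'n^'n" where
  "matrix_laplace_exponent Q \<mu> \<sigma> s =
     (s\<^sup>2 / 2) *\<^sub>R diag_mat (\<chi> i. (\<sigma> $ i)\<^sup>2) + s *\<^sub>R diag_mat \<mu> + Q"


section \<open>First passage\<close>

text \<open>\<open>hitting_times X x \<omega>\<close> is empty iff the level \<open>x\<close> is never passed; otherwise its infimum is the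
  first-passage time.\<close>

definition hitting_times :: "(real \<Rightarrow> 'w \<Rightarrow> real) \<Rightarrow> real \<Rightarrow> 'w \<Rightarrow> real set" where
  "hitting_times X x \<omega> = {t. 0 < t \<and> x \<le> X t \<omega>}"

definition first_passage_transform ::
  "'w measure \<Rightarrow> (real \<Rightarrow> 'w \<Rightarrow> real) \<Rightarrow> (real \<Rightarrow> 'w \<Rightarrow> 'n) \<Rightarrow> real \<Rightarrow> real \<Rightarrow> 'n \<Rightarrow> real" where
  "first_passage_transform M X J q x j =
     (LINT \<omega>|M. (if hitting_times X x \<omega> \<noteq> {} \<and> J (Inf (hitting_times X x \<omega>)) \<omega> = j
                  then exp (- q * Inf (hitting_times X x \<omega>)) else 0))"

text \<open>For \<open>s = 1\<close> this is the matrix \<open>\<Lambda>\<^sup>+\<^sub>q\<close> of the first passage upwards, for \<open>s = -1\<close> the matrix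
  \<open>\<Lambda>\<^sup>-\<^sub>q\<close> of the first passage downwards. The quadratic matrix equation on its own has further
  solutions; the first-passage identity singles one out.\<close>

definition first_passage_rate_matrix ::
  "real^'n^'n \<Rightarrow> real^'n \<Rightarrow> real^'n \<Rightarrow> ('n \<Rightarrow> 'w measure) \<Rightarrow> (real \<Rightarrow> 'w \<Rightarrow> real) \<Rightarrow>
     (real \<Rightarrow> 'w \<Rightarrow> 'n::finite) \<Rightarrow> real \<Rightarrow> real \<Rightarrow> real^'n^'n \<Rightarrow> bool" where
  "first_passage_rate_matrix Q \<mu> \<sigma> P X J s q \<Lambda> \<longleftrightarrow>
     diag_mat (\<chi> i. (\<sigma> $ i)\<^sup>2 / 2) ** (\<Lambda> ** \<Lambda>) - s *\<^sub>R (diag_mat \<mu> ** \<Lambda>) + (Q - q *\<^sub>R mat 1) = 0 \<and>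
     (\<forall>x\<ge>0. \<forall>i j. first_passage_transform (P i) (\<lambda>t \<omega>. s * X t \<omega>) J q x j
                    = mat_exp (x *\<^sub>R \<Lambda>) $ i $ j)"


section \<open>Scale matrices\<close>

definition scale_matrix ::
  "real^'n^'n \<Rightarrow> real^'n \<Rightarrow> real^'n \<Rightarrow> real \<Rightarrow> (real \<Rightarrow> real^'n^'n) \<Rightarrow> bool" where
  "scale_matrix Q \<mu> \<sigma> q W \<longleftrightarrow>
     continuous_on {0..} W \<and>
     (\<forall>x<0. W x = 0) \<and>
     (\<forall>\<^sub>F \<alpha> in at_top.
        invertible (matrix_laplace_exponent Q \<mu> \<sigma> \<alpha> - q *\<^sub>R mat 1) \<and>
        set_integrable lborel {0..} (\<lambda>x. exp (- \<alpha> * x) *\<^sub>R W x) \<and>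
        (LINT x:{0..}|lborel. exp (- \<alpha> * x) *\<^sub>R W x)
          = matrix_inv (matrix_laplace_exponent Q \<mu> \<sigma> \<alpha> - q *\<^sub>R mat 1))"

text \<open>The derivative of a scale matrix as a function on \<open>[0,\<infinity>)\<close>, hence one-sided at \<open>0\<close>, where the
  extension by \<open>0\<close> to the negative half-line has a kink: the right derivative there is the inverse
  of \<open>diag_mat (\<chi> i. (\<sigma> $ i)\<^sup>2 / 2)\<close>.\<close>

definition scale_deriv :: "(real \<Rightarrow> real^'n^'n) \<Rightarrow> real \<Rightarrow> real^'n^'n" where
  "scale_deriv W u = vector_derivative W (at u within {0..})"

text \<open>For a killing intensity that does not depend on the state of the chain. Local boundedness in
  the first argument is the class of functions in which the renewal equation has a unique
  solution.\<close>

definition omega_scale_matrix ::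
  "(real \<Rightarrow> real^'n^'n) \<Rightarrow> (real \<Rightarrow> real) \<Rightarrow> (real \<Rightarrow> real \<Rightarrow> real^'n^'n) \<Rightarrow> bool" where
  "omega_scale_matrix W \<omega> V \<longleftrightarrow>
     (\<forall>y b. bounded ((\<lambda>x. V x y) ` {y..b})) \<and>
     (\<forall>x y. y \<le> x \<longrightarrow>
        set_integrable lborel {y..x} (\<lambda>z. \<omega> z *\<^sub>R (W (x - z) ** V z y)) \<and>
        V x y = W (x - y) + (LINT z:{y..x}|lborel. \<omega> z *\<^sub>R (W (x - z) ** V z y)))"

end

theory Submission
  imports Defs "HOL-Real_Asymp.Real_Asymp"
begin

text \<open>Write \<open>D = diag (\<sigma>\<^sup>2 / 2)\<close> and \<open>M = diag \<mu>\<close>. The matrix power series \<open>U\<close> solving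
  \<open>D U'' + M U' + (Q - q) U = 0\<close>, \<open>U(0) = 0\<close>, \<open>D U'(0) = 1\<close> also solves the equation with the factors on the
  right, so its Laplace transform is the inverse of \<open>F(\<alpha>) - q\<close>; by uniqueness of Laplace transforms it is
  the scale matrix. Integrating by parts against \<open>W(x - z)\<close> turns a \<open>C\<^sup>1\<close> solution of
  \<open>D Z'' + M Z' + Q Z = \<omega> Z\<close>, \<open>Z(y) = 0\<close>, \<open>D Z'(y) = 1\<close> into a solution of the renewal equation, which is
  unique by Picard iteration. The asserted formula is this solution: beyond \<open>x\<^sub>1\<close> it continues
  \<open>W(x - y)\<close> with matching value and derivative. That \<open>\<Lambda>\<^sup>+ + \<Lambda>\<^sup>-\<close> is invertible follows from a maximum
  principle.\<close>

section \<open>Power series with matrix coefficients\<close>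

lemma bounded_bilinear_matrix_mult:
  "bounded_bilinear ((**) :: real^'n^'m \<Rightarrow> real^'k^'n \<Rightarrow> real^'k^'m)"
proof -
  have "bilinear ((**) :: real^'n^'m \<Rightarrow> real^'k^'n \<Rightarrow> real^'k^'m)"
    unfolding bilinear_def linear_iff
    by (auto simp: vec_eq_iff matrix_matrix_mult_def algebra_simps sum.distrib sum_distrib_left)
  then show ?thesis
    by (simp add: bilinear_conv_bounded_bilinear)
qed

text \<open>Supplies the product rule, limits, continuity and a norm bound for matrix
  products.\<close>

interpretation mm: bounded_bilinear "(**) :: real^'n^'m \<Rightarrow> real^'k^'n \<Rightarrow> real^'k^'m"
  by (rule bounded_bilinear_matrix_mult)

text \<open>Normal form for noncommutative algebra: products are multiplied out and bracketed to the
  right, with scalars and signs pulled out.\<close>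

lemmas mm_simps = mm.add_left mm.add_right mm.diff_left mm.diff_right mm.minus_left mm.minus_right
  mm.scaleR_left mm.scaleR_right mm.zero_left mm.zero_right matrix_mul_assoc[symmetric]

text \<open>Exponential generating function: for sequences of geometric growth \<open>c k\<close> is
  the \<open>k\<close>-th derivative at 0, so differentiation is a shift of the sequence.\<close>

definition egf :: "(nat \<Rightarrow> 'a::euclidean_space) \<Rightarrow> real \<Rightarrow> 'a" where
  "egf c x = (\<Sum>k. (x ^ k / fact k) *\<^sub>R c k)"

text \<open>Geometric growth gives convergence on the whole line, survives shifts, sums and bounded
  linear maps, and yields the exponential bound that the Laplace transform requires.\<close>

definition geo_bounded :: "(nat \<Rightarrow> 'a::real_normed_vector) \<Rightarrow> bool" where
  "geo_bounded c \<longleftrightarrow> (\<exists>B K. 0 \<le> B \<and> 0 < K \<and> (\<forall>k. norm (c k) \<le> B * K ^ k))"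

lemma geo_bounded_Suc:
  assumes "geo_bounded c" shows "geo_bounded (\<lambda>k. c (Suc k))"
proof -
  obtain B K where "0 \<le> B" "0 < K" and *: "\<And>k. norm (c k) \<le> B * K ^ k"
    using assms unfolding geo_bounded_def by blast
  have "norm (c (Suc k)) \<le> (B * K) * K ^ k" for k
    using *[of "Suc k"] by (simp add: mult_ac)
  then show ?thesis
    using \<open>0 \<le> B\<close> \<open>0 < K\<close> unfolding geo_bounded_def by (intro exI[of _ "B * K"] exI[of _ K]) auto
qed

lemma egf_summable_norm:
  assumes "geo_bounded c" shows "summable (\<lambda>k. norm ((x ^ k / fact k) *\<^sub>R c k))"
proof -
  obtain B K where "0 \<le> B" "0 < K" and *: "\<And>k. norm (c k) \<le> B * K ^ k"
    using assms unfolding geo_bounded_def by blast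
  have "summable (\<lambda>k. B * ((\<bar>x\<bar> * K) ^ k / fact k))"
    using summable_exp[of "\<bar>x\<bar> * K"] by (intro summable_mult) (simp add: field_simps)
  then show ?thesis
  proof (rule summable_comparison_test'[where N = 0])
    show "norm (norm ((x ^ n / fact n) *\<^sub>R c n)) \<le> B * ((\<bar>x\<bar> * K) ^ n / fact n)" for n
      using mult_left_mono[OF *[of n], of "\<bar>x\<bar> ^ n / fact n"]
      by (simp add: power_abs power_mult_distrib mult_ac)
  qed
qed

lemma egf_norm_le:
  assumes "0 < K" and *: "\<And>k. norm (c k) \<le> B * K ^ k"
  shows "norm (egf c x) \<le> B * exp (K * \<bar>x\<bar>)"
proof -
  have "0 \<le> B" using *[of 0] norm_ge_zero[of "c 0"] by simp (meson order_trans norm_ge_zero)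
  then have s: "summable (\<lambda>k. norm ((x ^ k / fact k) *\<^sub>R c k))"
    using assms by (intro egf_summable_norm) (auto simp: geo_bounded_def)
  have e: "(\<lambda>k. B * ((K * \<bar>x\<bar>) ^ k /\<^sub>R fact k)) sums (B * exp (K * \<bar>x\<bar>))"
    by (intro sums_mult exp_converges)
  have "norm (egf c x) \<le> (\<Sum>k. norm ((x ^ k / fact k) *\<^sub>R c k))"
    unfolding egf_def by (rule summable_norm[OF s])
  also have "\<dots> \<le> (\<Sum>k. B * ((K * \<bar>x\<bar>) ^ k /\<^sub>R fact k))"
  proof (rule suminf_le[OF _ s])
    show "norm ((x ^ n / fact n) *\<^sub>R c n) \<le> B * ((K * \<bar>x\<bar>) ^ n /\<^sub>R fact n)" for n
      using mult_left_mono[OF *[of n], of "\<bar>x\<bar> ^ n / fact n"]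
      by (simp add: power_abs power_mult_distrib field_simps)
  qed (use e in \<open>auto simp: sums_iff\<close>)
  also have "\<dots> = B * exp (K * \<bar>x\<bar>)" using e by (simp add: sums_iff)
  finally show ?thesis .
qed

lemma egf_0 [simp]: "egf c 0 = c 0"
proof -
  have "(\<lambda>k. (0 ^ k / fact k) *\<^sub>R c k) sums (\<Sum>k\<in>{0}. (0 ^ k / fact k) *\<^sub>R c k)"
    by (rule sums_finite) (auto simp: power_0_left)
  then show ?thesis by (simp add: egf_def sums_iff)
qed

lemma egf_linear:
  assumes "geo_bounded c" "bounded_linear f"
  shows "f (egf c x) = egf (\<lambda>k. f (c k)) x"
proof -
  have "summable (\<lambda>k. (x ^ k / fact k) *\<^sub>R c k)"
    using egf_summable_norm[OF assms(1)] by (rule summable_norm_cancel)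
  from bounded_linear.suminf[OF assms(2) this] show ?thesis
    by (simp add: egf_def linear_simps[OF assms(2)])
qed

lemma egf_add:
  assumes "geo_bounded c" "geo_bounded d"
  shows "egf c x + egf d x = egf (\<lambda>k. c k + d k) x"
  unfolding egf_def scaleR_add_right
  by (rule suminf_add) (use assms[THEN egf_summable_norm, THEN summable_norm_cancel] in auto)

text \<open>In each coordinate this is termwise differentiation of a real power series; the division
  by \<open>fact k\<close> turns \<open>diffs\<close> into the shift.\<close>

lemma egf_deriv:
  fixes c :: "nat \<Rightarrow> 'a::euclidean_space"
  assumes "geo_bounded c"
  shows "(egf c has_vector_derivative egf (\<lambda>k. c (Suc k)) x) (at x)"
proof -
  have "((\<lambda>x. egf c x \<bullet> b) has_derivative (\<lambda>h. (h *\<^sub>R egf (\<lambda>k. c (Suc k)) x) \<bullet> b)) (at x)"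
    if "b \<in> Basis" for b
  proof -
    let ?a = "\<lambda>k. (c k \<bullet> b) / fact k"
    have lin: "egf c x \<bullet> b = (\<Sum>k. ((c k \<bullet> b) / fact k) * x ^ k)" if "geo_bounded c" for c :: "nat \<Rightarrow> 'a" and x
      using egf_linear[OF that bounded_linear_inner_left[of b], of x]
      by (simp add: egf_def mult_ac)
    have "summable (\<lambda>k. ?a k * y ^ k)" for y
    proof -
      have "summable (\<lambda>k. (y ^ k / fact k) *\<^sub>R c k)"
        using egf_summable_norm[OF assms] by (rule summable_norm_cancel)
      from bounded_linear.summable[OF bounded_linear_inner_left[of b] this]
      show ?thesis by (simp add: mult_ac)
    qed
    from termdiffs_strong_converges_everywhere[OF this, of x]
    have "((\<lambda>x. egf c x \<bullet> b) has_field_derivative (egf (\<lambda>k. c (Suc k)) x \<bullet> b)) (at x)"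
      unfolding lin[OF assms] lin[OF geo_bounded_Suc[OF assms]]
      by (simp add: diffs_def)
    then show ?thesis
      by (simp add: has_field_derivative_def mult_commute_abs)
  qed
  then show ?thesis
    unfolding has_vector_derivative_def by (subst has_derivative_componentwise_within) auto
qed

lemma geo_bounded_linear:
  assumes "geo_bounded c" "bounded_linear f"
  shows "geo_bounded (\<lambda>k. f (c k))"
proof -
  obtain B K where B: "0 \<le> B" "0 < K" and *: "\<And>k. norm (c k) \<le> B * K ^ k"
    using assms unfolding geo_bounded_def by blast
  obtain L where L: "0 < L" "\<And>x. norm (f x) \<le> norm x * L"
    using bounded_linear.pos_bounded[OF assms(2)] by blast
  have "norm (f (c k)) \<le> (B * L) * K ^ k" for k
    using order_trans[OF L(2) mult_right_mono[OF *[of k], of L]] L(1) by (simp add: mult_ac)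
  then show ?thesis
    using B L(1) unfolding geo_bounded_def by (intro exI[of _ "B * L"] exI[of _ K]) auto
qed

lemma geo_bounded_add:
  assumes "geo_bounded c" "geo_bounded d"
  shows "geo_bounded (\<lambda>k. c k + d k)"
proof -
  obtain B K where B: "0 \<le> B" "0 < K" and c: "\<And>k. norm (c k) \<le> B * K ^ k"
    using assms unfolding geo_bounded_def by blast
  obtain C L where C: "0 \<le> C" "0 < L" and d: "\<And>k. norm (d k) \<le> C * L ^ k"
    using assms unfolding geo_bounded_def by blast
  have "norm (c k + d k) \<le> (B + C) * max K L ^ k" for k
  proof -
    have "norm (c k + d k) \<le> B * K ^ k + C * L ^ k"
      using norm_triangle_ineq[of "c k" "d k"] c[of k] d[of k] by linarith
    also have "\<dots> \<le> B * max K L ^ k + C * max K L ^ k"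
      using B C by (intro add_mono mult_left_mono power_mono) auto
    finally show ?thesis by (simp add: algebra_simps)
  qed
  then show ?thesis
    using B C unfolding geo_bounded_def
    by (intro exI[of _ "B + C"] exI[of _ "max K L"]) auto
qed

section \<open>The matrix exponential as a power series\<close>

lemma mat_pow_scaleR: "mat_pow (x *\<^sub>R A) k = x ^ k *\<^sub>R mat_pow A k"
  by (induction k) (auto simp: mat_pow_def mm_simps)

lemma mat_pow_0: "mat_pow A 0 = mat 1" and mat_pow_Suc: "mat_pow A (Suc k) = A ** mat_pow A k"
  by (auto simp: mat_pow_def)

lemma geo_bounded_mat_pow: "geo_bounded (mat_pow (A :: real^'n^'n))"
proof -
  obtain C where C: "C > 0" "\<And>a b. norm (a ** b) \<le> norm (a::real^'n^'n) * norm (b::real^'n^'n) * C"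
    using mm.pos_bounded by blast
  define K where "K = norm A * C + 1"
  \<comment> \<open>The summand 1 in \<open>K\<close> keeps the ratio positive even when
    \<open>A = 0\<close>.\<close>
  have K: "K > 0" "norm A * C \<le> K" using C(1) by (auto simp: K_def add_nonneg_pos)
  have "norm (mat_pow A k) \<le> norm (mat 1 :: real^'n^'n) * K ^ k" for k
  proof (induction k)
    case (Suc k)
    have "norm (mat_pow A (Suc k)) \<le> (norm A * C) * norm (mat_pow A k)"
      using C(2)[of A "mat_pow A k"] by (simp add: mat_pow_Suc mult_ac)
    also have "\<dots> \<le> K * (norm (mat 1 :: real^'n^'n) * K ^ k)"
      using K C(1) by (intro mult_mono Suc.IH) auto
    finally show ?case by (simp add: mult_ac)
  qed (simp add: mat_pow_0)
  then show ?thesis unfolding geo_bounded_def using K(1) norm_ge_zero by blast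
qed

lemma mat_exp_egf: "mat_exp (x *\<^sub>R A) = egf (mat_pow A) x"
  by (simp add: mat_exp_def egf_def mat_pow_scaleR)

lemma mat_exp_0: "mat_exp (0 :: real^'n^'n) = mat 1"
  using mat_exp_egf[of 0 "0 :: real^'n^'n"] by (simp add: mat_pow_0)

lemma mat_exp_deriv:
  "((\<lambda>x. mat_exp (x *\<^sub>R A)) has_vector_derivative A ** mat_exp (x *\<^sub>R A)) (at x)"
proof -
  have "egf (\<lambda>k. mat_pow A (Suc k)) x = A ** egf (mat_pow A) x"
    unfolding mat_pow_Suc
    by (rule egf_linear[OF geo_bounded_mat_pow mm.bounded_linear_right, symmetric])
  then show ?thesis
    using egf_deriv[OF geo_bounded_mat_pow, of A x] by (simp add: mat_exp_egf)
qed

section \<open>Power series of the scale matrices\<close>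

text \<open>Taylor coefficients at \<open>0\<close> of the solution of \<open>D U'' + M U' + R U = 0\<close>, \<open>U(0) = 0\<close>, \<open>D U'(0) = 1\<close>;
  \<open>G\<close> is the inverse of \<open>D\<close>.\<close>

fun scale_coeff :: "real^'n^'n \<Rightarrow> real^'n^'n \<Rightarrow> real^'n^'n \<Rightarrow> nat \<Rightarrow> real^'n^'n" where
  "scale_coeff G M R 0 = 0"
| "scale_coeff G M R (Suc 0) = G"
| "scale_coeff G M R (Suc (Suc k)) = - (G ** (M ** scale_coeff G M R (Suc k) + R ** scale_coeff G M R k))"

declare scale_coeff.simps(3) [simp del]

text \<open>Up to sign, each coefficient is the sum of all words \<open>G\<close>, letter,
  \<open>G\<close>, ..., letter, \<open>G\<close> with letters \<open>M\<close> (weight 1) and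
  \<open>R\<close> (weight 2) of fixed total weight. Such a sum can be peeled from either
  end.\<close>

lemma scale_coeff_right: "scale_coeff G M R (Suc (Suc k)) = - ((scale_coeff G M R (Suc k) ** M + scale_coeff G M R k ** R) ** G)"
proof (induction k rule: less_induct)
  case (less k)
  \<comment> \<open>The induction hypothesis is used at \<open>k - 1\<close> and
    \<open>k - 2\<close>, which leaves two base cases.\<close>
  consider "k = 0" | "k = 1" | j where "k = Suc (Suc j)"
    by (metis One_nat_def not0_implies_Suc)
  then show ?case
  proof cases
    case (3 j)
    let ?a = "scale_coeff G M R"
    have r: "?a (Suc (Suc (Suc j))) = - ((?a (Suc (Suc j)) ** M + ?a (Suc j) ** R) ** G)"
        "?a (Suc (Suc j)) = - ((?a (Suc j) ** M + ?a j ** R) ** G)"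
      using less.IH[of "Suc j"] less.IH[of j] 3 by auto
    have l: "?a (Suc (Suc (Suc j))) = - (G ** (M ** ?a (Suc (Suc j)) + R ** ?a (Suc j)))"
        "?a (Suc (Suc j)) = - (G ** (M ** ?a (Suc j) + R ** ?a j))"
      by (rule scale_coeff.simps(3))+
    \<comment> \<open>Coefficients followed by \<open>M\<close> or \<open>R\<close> are expanded by
      the defining recursion, those preceded by them by the induction hypothesis; both sides then
      consist of the same products.\<close>
    have "?a (Suc k) ** M = - (G ** (M ** ?a (Suc (Suc j)) + R ** ?a (Suc j))) ** M"
         "?a k ** R = - (G ** (M ** ?a (Suc j) + R ** ?a j)) ** R"
         "M ** ?a (Suc k) = M ** - ((?a (Suc (Suc j)) ** M + ?a (Suc j) ** R) ** G)"
         "R ** ?a k = R ** - ((?a (Suc j) ** M + ?a j ** R) ** G)"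
      using r l by (simp_all only: 3)
    then show ?thesis
      unfolding scale_coeff.simps(3)[of G M R k] by (simp add: mm_simps)
  qed (simp_all add: mm_simps One_nat_def scale_coeff.simps(3))
qed

lemma geo_bounded_scale_coeff: "geo_bounded (scale_coeff G M (R :: real^'n^'n))"
proof -
  obtain C where C: "C > 0" "\<And>a b. norm (a ** b) \<le> norm (a::real^'n^'n) * norm (b::real^'n^'n) * C"
    using mm.pos_bounded by blast
  define L where "L = 1 + C * norm G * (C * norm M + C * norm R)"
  have L: "L \<ge> 1" using C(1) by (simp add: L_def)
  have step: "norm (scale_coeff G M R (Suc (Suc k))) \<le> L * (norm (scale_coeff G M R (Suc k)) + norm (scale_coeff G M R k))" for k
  proof -
    let ?a = "scale_coeff G M R (Suc k)" and ?b = "scale_coeff G M R k"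
    have "norm (scale_coeff G M R (Suc (Suc k))) \<le> C * norm G * norm (M ** ?a + R ** ?b)"
      using C(2)[of G "M ** ?a + R ** ?b"] by (simp add: scale_coeff.simps(3) mult_ac)
    also have "\<dots> \<le> C * norm G * (C * norm M * norm ?a + C * norm R * norm ?b)"
      using C(2)[of M ?a] C(2)[of R ?b] C(1)
      by (intro mult_left_mono order_trans[OF norm_triangle_ineq] add_mono) (auto simp: mult_ac)
    also have "\<dots> \<le> C * norm G * ((C * norm M + C * norm R) * (norm ?a + norm ?b))"
      using C(1) by (intro mult_left_mono) (auto simp: algebra_simps)
    also have "\<dots> \<le> L * (norm ?a + norm ?b)"
      unfolding L_def by (simp add: algebra_simps)
    finally show ?thesis .
  qed
  \<comment> \<open>The recursion has depth two, so two consecutive bounds are carried along. Since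
    \<open>L \<ge> 1\<close>, the older one can be enlarged to the newer, and the two equal terms
    give the ratio \<open>2 * L\<close>.\<close>
  have "norm (scale_coeff G M R k) \<le> norm G * (2 * L) ^ k \<and> norm (scale_coeff G M R (Suc k)) \<le> norm G * (2 * L) ^ Suc k" for k
  proof (induction k)
    case 0
    show ?case using L mult_left_mono[of 1 "2 * L" "norm G"] by simp
  next
    case (Suc k)
    let ?t = "norm G * (2 * L) ^ k"
    have "0 \<le> ?t" using L by auto
    then have t: "?t \<le> 2 * L * ?t" using L mult_right_mono[of 1 "2 * L" ?t] by simp
    have "norm (scale_coeff G M R (Suc (Suc k))) \<le> L * (2 * L * ?t + 2 * L * ?t)"
      using Suc.IH L t by (intro order_trans[OF step] mult_left_mono add_mono) (auto simp: mult_ac)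
    then show ?case using Suc.IH by (simp add: mult_ac)
  qed
  then show ?thesis using L unfolding geo_bounded_def
    by (intro exI[of _ "norm G"] exI[of _ "2 * L"]) auto
qed

definition scale_sol :: "real^'n^'n \<Rightarrow> real^'n^'n \<Rightarrow> real^'n^'n \<Rightarrow> real \<Rightarrow> real^'n^'n" where
  "scale_sol G M R = egf (scale_coeff G M R)"

definition scale_sol' :: "real^'n^'n \<Rightarrow> real^'n^'n \<Rightarrow> real^'n^'n \<Rightarrow> real \<Rightarrow> real^'n^'n" where
  "scale_sol' G M R = egf (\<lambda>k. scale_coeff G M R (Suc k))"

definition scale_sol'' :: "real^'n^'n \<Rightarrow> real^'n^'n \<Rightarrow> real^'n^'n \<Rightarrow> real \<Rightarrow> real^'n^'n" where
  "scale_sol'' G M R = egf (\<lambda>k. scale_coeff G M R (Suc (Suc k)))"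

lemma scale_sol_0 [simp]: "scale_sol G M R 0 = 0" and scale_sol'_0 [simp]: "scale_sol' G M R 0 = G"
  by (simp_all add: scale_sol_def scale_sol'_def)

lemma scale_sol_deriv: "(scale_sol G M R has_vector_derivative scale_sol' G M R x) (at x)"
  and scale_sol'_deriv: "(scale_sol' G M R has_vector_derivative scale_sol'' G M R x) (at x)"
  unfolding scale_sol_def scale_sol'_def scale_sol''_def
  by (intro egf_deriv geo_bounded_Suc geo_bounded_scale_coeff)+

text \<open>\<open>D\<close> cancels the leading \<open>G\<close> of the recursion term by term.
  This side yields the differential equation of the candidate solution.\<close>

lemma scale_sol_ode_left:
  assumes "D ** G = mat 1"
  shows "D ** scale_sol'' G M R x + M ** scale_sol' G M R x + R ** scale_sol G M R x = 0"
proof -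
  note gb = geo_bounded_scale_coeff[of G M R]
  note gb1 = geo_bounded_Suc[OF gb]
  note gb2 = geo_bounded_Suc[OF gb1]
  note lin = egf_linear[OF _ mm.bounded_linear_right]
  have gm: "geo_bounded (\<lambda>k. M ** scale_coeff G M R (Suc k))" "geo_bounded (\<lambda>k. R ** scale_coeff G M R k)"
    using gb gb1 by (auto intro: geo_bounded_linear mm.bounded_linear_right)
  have "D ** scale_coeff G M R (Suc (Suc k)) = - (M ** scale_coeff G M R (Suc k) + R ** scale_coeff G M R k)" for k
    by (simp only: scale_coeff.simps(3) mm.minus_right matrix_mul_assoc assms matrix_mul_lid)
  note eq = this
  show ?thesis
    unfolding scale_sol_def scale_sol'_def scale_sol''_def lin[OF gb] lin[OF gb1] lin[OF gb2] eq
    by (simp only: egf_add[OF gm] add.assoc left_minus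
        egf_linear[OF geo_bounded_add[OF gm] bounded_linear_minus[OF bounded_linear_ident], symmetric])
qed

text \<open>Rests on \<open>scale_coeff_right\<close>. The Laplace transform and the integration by
  parts need this side, since there the scale matrix is the left factor.\<close>

lemma scale_sol_ode_right:
  assumes "G ** D = mat 1"
  shows "scale_sol'' G M R x ** D + scale_sol' G M R x ** M + scale_sol G M R x ** R = 0"
proof -
  note gb = geo_bounded_scale_coeff[of G M R]
  note gb1 = geo_bounded_Suc[OF gb]
  note gb2 = geo_bounded_Suc[OF gb1]
  note lin = egf_linear[OF _ mm.bounded_linear_left]
  have gm: "geo_bounded (\<lambda>k. scale_coeff G M R (Suc k) ** M)" "geo_bounded (\<lambda>k. scale_coeff G M R k ** R)"
    using gb gb1 by (auto intro: geo_bounded_linear mm.bounded_linear_left)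
  have "scale_coeff G M R (Suc (Suc k)) ** D = - (scale_coeff G M R (Suc k) ** M + scale_coeff G M R k ** R)" for k
    by (simp only: scale_coeff_right mm.minus_left matrix_mul_assoc[symmetric] assms matrix_mul_rid)
  note eq = this
  show ?thesis
    unfolding scale_sol_def scale_sol'_def scale_sol''_def lin[OF gb] lin[OF gb1] lin[OF gb2] eq
    by (simp only: egf_add[OF gm] add.assoc left_minus
        egf_linear[OF geo_bounded_add[OF gm] bounded_linear_minus[OF bounded_linear_ident], symmetric])
qed

text \<open>Shifting the coefficients costs a factor \<open>K\<close>, which the constant
  \<open>B * (1 + K)\<close> absorbs, so one rate serves the series and its derivative.\<close>

lemma scale_sol_bounds:
  obtains B K where "0 < K" "\<And>x. norm (scale_sol G M R x) \<le> B * exp (K * \<bar>x\<bar>)"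
    "\<And>x. norm (scale_sol' G M R x) \<le> B * exp (K * \<bar>x\<bar>)"
proof -
  obtain B K where B: "0 \<le> B" "0 < K" and *: "\<And>k. norm (scale_coeff G M R k) \<le> B * K ^ k"
    using geo_bounded_scale_coeff[of G M R] unfolding geo_bounded_def by blast
  have "norm (scale_coeff G M R k) \<le> (B * (1 + K)) * K ^ k" "norm (scale_coeff G M R (Suc k)) \<le> (B * (1 + K)) * K ^ k" for k
  proof -
    have "(B * (1 + K)) * K ^ k = B * K ^ k + B * K ^ Suc k" "0 \<le> B * K ^ k" "0 \<le> B * K ^ Suc k"
      using B by (auto simp: algebra_simps)
    with *[of k] *[of "Suc k"]
    show "norm (scale_coeff G M R k) \<le> (B * (1 + K)) * K ^ k" "norm (scale_coeff G M R (Suc k)) \<le> (B * (1 + K)) * K ^ k"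
      by linarith+
  qed
  from this[THEN egf_norm_le[OF \<open>0 < K\<close>]] show ?thesis
    using that[of K "B * (1 + K)"] \<open>0 < K\<close> by (simp add: scale_sol_def scale_sol'_def)
qed

text \<open>The derivative of \<open>e\<^sup>-\<^sup>\<alpha>\<^sup>x (U' D + U (\<alpha> D + M))\<close> is \<open>- e\<^sup>-\<^sup>\<alpha>\<^sup>x U (\<alpha>\<^sup>2 D + \<alpha> M + R)\<close> by the differential
  equation, and the boundary value at \<open>0\<close> is \<open>1\<close>.\<close>

lemma scale_sol_laplace:
  fixes D G M R :: "real^'n^'n"
  assumes "G ** D = mat 1"
  shows "\<forall>\<^sub>F \<alpha> in at_top. set_integrable lborel {0..} (\<lambda>x. exp (- \<alpha> * x) *\<^sub>R scale_sol G M R x) \<and>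
    (LINT x:{0..}|lborel. exp (- \<alpha> * x) *\<^sub>R scale_sol G M R x) ** (\<alpha>\<^sup>2 *\<^sub>R D + \<alpha> *\<^sub>R M + R) = mat 1"
proof -
  obtain B K where K: "0 < K" and B: "\<And>x. norm (scale_sol G M R x) \<le> B * exp (K * \<bar>x\<bar>)"
    "\<And>x. norm (scale_sol' G M R x) \<le> B * exp (K * \<bar>x\<bar>)"
    using scale_sol_bounds by metis
  let ?U = "scale_sol G M R" and ?U' = "scale_sol' G M R" and ?U'' = "scale_sol'' G M R"
  show ?thesis
    using eventually_gt_at_top[of K]
  proof eventually_elim
    case (elim \<alpha>)
    have contU: "continuous_on A ?U" for A
      using scale_sol_deriv by (intro continuous_at_imp_continuous_on ballI has_vector_derivative_continuous)
    have bd: "norm (exp (- \<alpha> * x) *\<^sub>R f x) \<le> B * exp (- (\<alpha> - K) * x)"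
      if "\<And>x. norm (f x) \<le> B * exp (K * \<bar>x\<bar>)" "0 \<le> x" for f :: "real \<Rightarrow> real^'n^'n" and x
      using mult_left_mono[OF that(1)[of x], of "exp (- \<alpha> * x)"] that(2)
      by (simp add: exp_diff exp_minus field_simps left_diff_distrib)
    have "(\<lambda>x. exp (- (\<alpha> - K) * x)) absolutely_integrable_on {0..}"
      using elim
      by (intro nonnegative_absolutely_integrable_1 integrable_on_exp_minus_to_infinity) auto
    then have "set_integrable lborel {0..} (\<lambda>x. exp (- (\<alpha> - K) * x))"
      unfolding set_integrable_def by (subst (asm) integrable_completion) auto
    then have ie: "set_integrable lborel {0..} (\<lambda>x. B * exp (- (\<alpha> - K) * x))"
      by (rule set_integrable_mult_right)
    have int: "set_integrable lborel {0..} (\<lambda>x. exp (- \<alpha> * x) *\<^sub>R ?U x)"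
    proof (rule set_integrable_bound[OF ie])
      show "set_borel_measurable lborel {0..} (\<lambda>x. exp (- \<alpha> * x) *\<^sub>R ?U x)"
      proof -
        have cont: "continuous_on {0..} (\<lambda>x. exp (- \<alpha> * x) *\<^sub>R ?U x)"
          by (intro continuous_intros contU)
        show ?thesis
          using set_measurable_continuous_on[OF _ cont] by (simp add: set_borel_measurable_def)
      qed
      show "AE x in lborel. x \<in> {0..} \<longrightarrow> norm (exp (- \<alpha> * x) *\<^sub>R ?U x) \<le> norm (B * exp (- (\<alpha> - K) * x))"
        using bd[OF B(1)] by (auto intro!: AE_I2 order_trans[OF _ abs_ge_self])
    qed
    define F where "F = \<alpha>\<^sup>2 *\<^sub>R D + \<alpha> *\<^sub>R M + R"
    define P where "P x = exp (- \<alpha> * x) *\<^sub>R (?U' x ** D + ?U x ** (\<alpha> *\<^sub>R D + M))" for x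
    have der: "(P has_vector_derivative (exp (- \<alpha> * x) *\<^sub>R ?U x) ** (- F)) (at x)" for x
    proof -
      have "(P has_vector_derivative
          (exp (- \<alpha> * x) *\<^sub>R (?U'' x ** D + ?U' x ** (\<alpha> *\<^sub>R D + M))
           + (- \<alpha> * exp (- \<alpha> * x)) *\<^sub>R (?U' x ** D + ?U x ** (\<alpha> *\<^sub>R D + M)))) (at x)"
        unfolding P_def
        by (intro has_vector_derivative_scaleR has_vector_derivative_add
            bounded_linear.has_vector_derivative[OF mm.bounded_linear_left]
            scale_sol_deriv scale_sol'_deriv)
          (auto intro!: derivative_eq_intros)
      also have "?U'' x ** D = - (?U' x ** M) - ?U x ** R"
        using scale_sol_ode_right[OF assms, of M R x] by (simp add: algebra_simps eq_neg_iff_add_eq_0)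
      finally show ?thesis
        by (simp add: F_def mm_simps scaleR_add_right scaleR_diff_right power2_eq_square mult_ac)
    qed
    let ?f = "\<lambda>x. (exp (- \<alpha> * x) *\<^sub>R ?U x) ** (- F)"
    have intF: "set_integrable lborel {0..} ?f"
      and LF: "(LINT x:{0..}|lborel. ?f x) = (LINT x:{0..}|lborel. exp (- \<alpha> * x) *\<^sub>R ?U x) ** (- F)"
      using integrable_bounded_linear[OF mm.bounded_linear_left int[unfolded set_integrable_def], of "- F"]
        integral_bounded_linear[OF mm.bounded_linear_left int[unfolded set_integrable_def], of "- F"]
      by (simp_all add: set_integrable_def set_lebesgue_integral_def mm.scaleR_left)
    \<comment> \<open>The integrals over \<open>{0..b}\<close> have two limits to compare: the
      integral over the half-line, and the limit of \<open>P b - P 0\<close>, where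
      \<open>P b\<close> decays and \<open>P 0 = mat 1\<close>.\<close>
    have lim: "((\<lambda>b. LINT x:{0..b}|lborel. ?f x) \<longlongrightarrow> (LINT x:{0..}|lborel. ?f x)) at_top"
      by (rule tendsto_set_lebesgue_integral_at_top[OF _ intF]) auto
    have "((\<lambda>b. LINT x:{0..b}|lborel. ?f x) \<longlongrightarrow> 0 - mat 1) at_top"
    proof (rule Lim_transform_eventually)
      have "((\<lambda>b. exp (- \<alpha> * b) *\<^sub>R f b) \<longlongrightarrow> 0) at_top"
        if f: "\<And>x. norm (f x) \<le> B * exp (K * \<bar>x\<bar>)" for f :: "real \<Rightarrow> real^'n^'n"
      proof (rule Lim_null_comparison)
        show "\<forall>\<^sub>F b in at_top. norm (exp (- \<alpha> * b) *\<^sub>R f b) \<le> B * exp (- (\<alpha> - K) * b)"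
          using eventually_ge_at_top[of 0] by eventually_elim (rule bd[OF f])
        show "((\<lambda>b. B * exp (- (\<alpha> - K) * b)) \<longlongrightarrow> 0) at_top"
          using elim by real_asymp
      qed
      from this[OF B(1)] this[OF B(2)]
      have "((\<lambda>b. (exp (- \<alpha> * b) *\<^sub>R ?U' b) ** D + (exp (- \<alpha> * b) *\<^sub>R ?U b) ** (\<alpha> *\<^sub>R D + M))
          \<longlongrightarrow> 0 ** D + 0 ** (\<alpha> *\<^sub>R D + M)) at_top"
        by (intro tendsto_add mm.tendsto tendsto_const)
      then have "(P \<longlongrightarrow> 0) at_top"
        unfolding P_def by (simp add: mm.scaleR_left scaleR_add_right mm.zero_left)
      then show "((\<lambda>b. P b - mat 1) \<longlongrightarrow> 0 - mat 1) at_top"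
        by (intro tendsto_intros)
      have P0: "P 0 = mat 1" by (simp add: P_def assms mm.zero_left)
      show "\<forall>\<^sub>F b in at_top. P b - mat 1 = (LINT x:{0..b}|lborel. ?f x)"
        using eventually_ge_at_top[of 0]
      proof eventually_elim
        case (elim b)
        show ?case
          unfolding set_lebesgue_integral_def P0[symmetric]
          by (rule integral_FTC_atLeastAtMost[OF elim, symmetric])
            (rule has_vector_derivative_at_within[OF der], intro continuous_intros mm.continuous_on contU)
      qed
    qed
    from tendsto_unique[OF _ lim this]
    have "(LINT x:{0..}|lborel. exp (- \<alpha> * x) *\<^sub>R ?U x) ** F = mat 1"
      unfolding LF by (simp add: mm.minus_right)
    then show ?case using int by (simp add: F_def)
  qed
qed

section \<open>Uniqueness of Laplace transforms\<close>

text \<open>With \<open>t = exp (- x)\<close>, the zeros at \<open>a\<close>, \<open>a + 1\<close>,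
  ... say that the weighted function is orthogonal to all polynomials in \<open>t\<close>. By
  Weierstrass it is then orthogonal to a continuous test function, chosen so that the integrand
  becomes a nonnegative multiple of the square of \<open>h\<close>.\<close>

lemma laplace_zero_imp_zero:
  fixes h :: "real \<Rightarrow> real"
  assumes cont: "continuous_on {0..} h"
    and int: "\<And>n. set_integrable lborel {0..} (\<lambda>x. exp (- (a + real n) * x) * h x)"
    and zero: "\<And>n. (LINT x:{0..}|lborel. exp (- (a + real n) * x) * h x) = 0"
    and "0 \<le> x0"
  shows "h x0 = 0"
proof -
  \<comment> \<open>Placing \<open>x0\<close> strictly below \<open>b\<close> keeps the weight
    \<open>b - x\<close> positive at \<open>x0\<close>.\<close>
  define b where "b = x0 + 1"
  have b: "0 \<le> x0" "x0 < b" using assms by (auto simp: b_def)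
  define w where "w x = exp (- a * x) * h x" for x
  have w: "exp (- (a + real n) * x) * h x = exp (- x) ^ n * w x" for n x
    by (simp add: w_def exp_of_nat_mult[symmetric] exp_add[symmetric] algebra_simps)
  have intw: "set_integrable lborel {0..} w"
    using int[of 0] by (simp add: w_def[abs_def])
  have poly: "set_integrable lborel {0..} (\<lambda>x. p (exp (- x)) * w x)"
    "(LINT x:{0..}|lborel. p (exp (- x)) * w x) = 0" if p: "real_polynomial_function p" for p
  proof -
    obtain c n where p: "p = (\<lambda>t. \<Sum>i\<le>n. c i * t ^ i)"
      using p unfolding real_polynomial_function_iff_sum by blast
    have *: "indicator {0..} x *\<^sub>R (p (exp (- x)) * w x)
        = (\<Sum>i\<le>n. c i * (indicator {0..} x *\<^sub>R (exp (- (a + real i) * x) * h x)))" for x :: real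
      unfolding w by (simp add: p sum_distrib_left sum_distrib_right mult_ac)
    show "set_integrable lborel {0..} (\<lambda>x. p (exp (- x)) * w x)"
      unfolding set_integrable_def *
      by (intro Bochner_Integration.integrable_sum integrable_mult_right int[unfolded set_integrable_def])
    show "(LINT x:{0..}|lborel. p (exp (- x)) * w x) = 0"
      unfolding set_lebesgue_integral_def *
      by (subst Bochner_Integration.integral_sum)
        (use int zero in \<open>simp_all add: set_integrable_def set_lebesgue_integral_def\<close>)
  qed
  \<comment> \<open>This is \<open>(b - x) * h x\<close> in the variable
    \<open>t = exp (- x)\<close>. The maximum avoids the logarithm at 0, and the factor
    \<open>b - y\<close> makes the function vanish where the maximum cuts off, that is for
    \<open>x > b\<close>.\<close>
  define \<phi> where "\<phi> t = (let y = - ln (max t (exp (- b))) in (b - y) * h y)" for t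
  have cont\<phi>: "continuous_on {0..1} \<phi>"
  proof -
    have pos: "0 < max t (exp (- b))" for t
      by (simp add: less_max_iff_disj)
    then have ne: "max t (exp (- b)) \<noteq> 0" for t
      by (metis less_irrefl)
    have y: "continuous_on {0..1} (\<lambda>t. - ln (max t (exp (- b))))"
      using ne by (intro continuous_intros) auto
    have "- ln (max t (exp (- b))) \<in> {0..}" if "t \<in> {0..1}" for t
      using that pos[of t] b by (simp add: ln_le_zero_iff)
    then have "continuous_on {0..1} (\<lambda>t. h (- ln (max t (exp (- b)))))"
      by (intro continuous_on_compose2[OF cont y]) blast
    then show ?thesis unfolding \<phi>_def Let_def by (intro continuous_on_mult continuous_on_diff continuous_on_const y)
  qed
  have \<phi>: "\<phi> (exp (- x)) * w x = indicator {0..b} x * ((b - x) * exp (- a * x) * (h x)\<^sup>2)" if "0 \<le> x" for x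
  proof (cases "x \<le> b")
    case True
    then have "max (exp (- x)) (exp (- b)) = exp (- x)" by simp
    then show ?thesis using True that by (simp add: \<phi>_def w_def power2_eq_square)
  next
    case False
    then have "max (exp (- x)) (exp (- b)) = exp (- b)" by simp
    then show ?thesis using False by (simp add: \<phi>_def)
  qed
  have "continuous_on {0..b} (\<lambda>x. (b - x) * exp (- a * x) * (h x)\<^sup>2)"
    by (intro continuous_intros continuous_on_subset[OF cont]) auto
  note contf = this
  have intf: "set_integrable lborel {0..b} (\<lambda>x. (b - x) * exp (- a * x) * (h x)\<^sup>2)"
    by (rule borel_integrable_atLeastAtMost'[OF contf])
  have ind: "indicator {0..} x *\<^sub>R (\<phi> (exp (- x)) * w x) = indicator {0..b} x *\<^sub>R ((b - x) * exp (- a * x) * (h x)\<^sup>2)" for x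
    using \<phi>[of x] by (auto simp: indicator_def)
  have int\<phi>: "set_integrable lborel {0..} (\<lambda>x. \<phi> (exp (- x)) * w x)"
    using intf unfolding set_integrable_def ind .
  have "\<bar>LINT x:{0..}|lborel. \<phi> (exp (- x)) * w x\<bar> \<le> 0"
  proof (rule field_le_epsilon)
    fix e :: real assume "0 < e"
    define L where "L = (LINT x:{0..}|lborel. \<bar>w x\<bar>)"
    have "L \<ge> 0" unfolding L_def set_lebesgue_integral_def by (rule integral_nonneg_AE) auto
    \<comment> \<open>\<open>L + 1\<close> instead of \<open>L\<close>, because \<open>L\<close> may
      be 0.\<close>
    then have "0 < e / (L + 1)" using \<open>0 < e\<close> by simp
    then obtain p where p: "real_polynomial_function p" "\<And>t. t \<in> {0..1} \<Longrightarrow> \<bar>\<phi> t - p t\<bar> < e / (L + 1)"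
      using Stone_Weierstrass_real_polynomial_function[OF compact_Icc cont\<phi>] by blast
    have "(LINT x:{0..}|lborel. \<phi> (exp (- x)) * w x)
        = (LINT x:{0..}|lborel. \<phi> (exp (- x)) * w x - p (exp (- x)) * w x)"
      using set_integral_diff[OF int\<phi> poly(1)[OF p(1)]] poly(2)[OF p(1)] by simp
    also have "\<bar>\<dots>\<bar> \<le> (LINT x:{0..}|lborel. \<bar>\<phi> (exp (- x)) * w x - p (exp (- x)) * w x\<bar>)"
      using set_integral_norm_bound[OF set_integral_diff(1)[OF int\<phi> poly(1)[OF p(1)]]] by simp
    also have "\<dots> \<le> (LINT x:{0..}|lborel. e / (L + 1) * \<bar>w x\<bar>)"
    proof (rule set_integral_mono)
      show "set_integrable lborel {0..} (\<lambda>x. \<bar>\<phi> (exp (- x)) * w x - p (exp (- x)) * w x\<bar>)"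
        by (intro set_integrable_abs set_integral_diff(1) int\<phi> poly(1) p)
      show "set_integrable lborel {0..} (\<lambda>x. e / (L + 1) * \<bar>w x\<bar>)"
        by (intro set_integrable_mult_right set_integrable_abs intw)
      show "\<bar>\<phi> (exp (- x)) * w x - p (exp (- x)) * w x\<bar> \<le> e / (L + 1) * \<bar>w x\<bar>" if "x \<in> {0..}" for x
      proof -
        have "\<bar>\<phi> (exp (- x)) - p (exp (- x))\<bar> \<le> e / (L + 1)"
          using p(2)[of "exp (- x)"] that by simp
        then show ?thesis
          unfolding left_diff_distrib[symmetric] abs_mult by (rule mult_right_mono) simp
      qed
    qed
    also have "\<dots> = e / (L + 1) * L" by (simp add: L_def)
    also have "\<dots> \<le> e" using \<open>0 < e\<close> \<open>L \<ge> 0\<close> by (simp add: field_simps)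
    finally show "\<bar>LINT x:{0..}|lborel. \<phi> (exp (- x)) * w x\<bar> \<le> 0 + e" by simp
  qed
  then have "(LINT x:{0..b}|lborel. (b - x) * exp (- a * x) * (h x)\<^sup>2) = 0"
    unfolding set_lebesgue_integral_def ind by simp
  then have "integral {0..b} (\<lambda>x. (b - x) * exp (- a * x) * (h x)\<^sup>2) = 0"
    using set_borel_integral_eq_integral(2)[OF intf] by simp
  then have "\<forall>x\<in>{0..b}. (b - x) * exp (- a * x) * (h x)\<^sup>2 = 0"
    by (subst (asm) integral_eq_0_iff[OF contf]) (use b in auto)
  then show ?thesis using b by (auto dest!: bspec[of _ _ x0])
qed

text \<open>The previous lemma applies to each coordinate of the difference, with \<open>a\<close>
  any point beyond which the transforms exist and agree.\<close>

lemma laplace_unique: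
  fixes f g :: "real \<Rightarrow> 'a::euclidean_space"
  assumes "continuous_on {0..} f" "continuous_on {0..} g"
    and ev: "\<forall>\<^sub>F \<alpha> in at_top. set_integrable lborel {0..} (\<lambda>x. exp (- \<alpha> * x) *\<^sub>R f x) \<and>
      set_integrable lborel {0..} (\<lambda>x. exp (- \<alpha> * x) *\<^sub>R g x) \<and>
      (LINT x:{0..}|lborel. exp (- \<alpha> * x) *\<^sub>R f x) = (LINT x:{0..}|lborel. exp (- \<alpha> * x) *\<^sub>R g x)"
    and "0 \<le> x"
  shows "f x = g x"
proof -
  obtain a where a: "\<And>\<alpha>. a \<le> \<alpha> \<Longrightarrow> set_integrable lborel {0..} (\<lambda>x. exp (- \<alpha> * x) *\<^sub>R f x)"
      "\<And>\<alpha>. a \<le> \<alpha> \<Longrightarrow> set_integrable lborel {0..} (\<lambda>x. exp (- \<alpha> * x) *\<^sub>R g x)"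
      "\<And>\<alpha>. a \<le> \<alpha> \<Longrightarrow> (LINT x:{0..}|lborel. exp (- \<alpha> * x) *\<^sub>R f x) = (LINT x:{0..}|lborel. exp (- \<alpha> * x) *\<^sub>R g x)"
    using ev unfolding eventually_at_top_linorder by blast
  have "f x \<bullet> i - g x \<bullet> i = 0" for i
  proof (rule laplace_zero_imp_zero[of "\<lambda>x. f x \<bullet> i - g x \<bullet> i" a])
    show "continuous_on {0..} (\<lambda>x. f x \<bullet> i - g x \<bullet> i)"
      using assms by (intro continuous_intros)
    fix n :: nat
    let ?\<alpha> = "a + real n"
    have *: "indicator {0..} x *\<^sub>R (exp (- ?\<alpha> * x) * (f x \<bullet> i - g x \<bullet> i)) =
       (indicator {0..} x *\<^sub>R exp (- ?\<alpha> * x) *\<^sub>R f x) \<bullet> i - (indicator {0..} x *\<^sub>R exp (- ?\<alpha> * x) *\<^sub>R g x) \<bullet> i" for x :: real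
      by (simp add: algebra_simps)
    have ai: "integrable lborel (\<lambda>x. (indicator {0..} x *\<^sub>R exp (- ?\<alpha> * x) *\<^sub>R f x) \<bullet> i)"
       "integrable lborel (\<lambda>x. (indicator {0..} x *\<^sub>R exp (- ?\<alpha> * x) *\<^sub>R g x) \<bullet> i)"
      using a(1,2)[of ?\<alpha>] unfolding set_integrable_def
      by (simp_all only: le_add_same_cancel1 of_nat_0_le_iff integrable_inner_left)
    show "set_integrable lborel {0..} (\<lambda>x. exp (- ?\<alpha> * x) * (f x \<bullet> i - g x \<bullet> i))"
      unfolding set_integrable_def * using ai by (rule Bochner_Integration.integrable_diff)
    show "(LINT x:{0..}|lborel. exp (- ?\<alpha> * x) * (f x \<bullet> i - g x \<bullet> i)) = 0"
      unfolding set_lebesgue_integral_def * Bochner_Integration.integral_diff[OF ai]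
      using a[of ?\<alpha>] unfolding set_lebesgue_integral_def set_integrable_def
      by (subst (1 2) integral_inner_left) auto
  qed fact
  then show ?thesis by (metis euclidean_eqI right_minus_eq)
qed

section \<open>Invertibility of the sum of the first-passage rate matrices\<close>

text \<open>The maximum is one-sided, so \<open>f' 0 < 0\<close> is possible and the second-order
  condition holds only when \<open>f' 0 = 0\<close>. In that case a positive \<open>c\<close> would
  make \<open>f'\<close> positive just to the right of 0, and \<open>f\<close> would grow by the
  mean value theorem.\<close>

lemma deriv_at_right_max:
  fixes f f' :: "real \<Rightarrow> real"
  assumes f: "\<And>t. (f has_real_derivative f' t) (at t)"
    and f': "(f' has_real_derivative c) (at 0)"
    and max: "\<And>t. 0 \<le> t \<Longrightarrow> f t \<le> f 0"
  shows "f' 0 \<le> 0" "f' 0 = 0 \<Longrightarrow> c \<le> 0"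
proof -
  show "f' 0 \<le> 0"
  proof (rule ccontr)
    assume "\<not> f' 0 \<le> 0"
    then obtain d where "d > 0" "\<And>h. 0 < h \<Longrightarrow> h < d \<Longrightarrow> f 0 < f h"
      using DERIV_pos_inc_right[OF f[of 0]] by auto
    then have "f 0 < f (d / 2)" by simp
    then show False using max[of "d / 2"] \<open>d > 0\<close> by simp
  qed
  assume 0: "f' 0 = 0"
  show "c \<le> 0"
  proof (rule ccontr)
    assume "\<not> c \<le> 0"
    then obtain d where d: "d > 0" "\<And>h. 0 < h \<Longrightarrow> h < d \<Longrightarrow> f' 0 < f' (0 + h)"
      using DERIV_pos_inc_right[OF f'] by auto
    obtain z where z: "0 < z" "z < d / 2" "f (d / 2) - f 0 = (d / 2 - 0) * f' z"
      using MVT2[of 0 "d / 2" f f'] f d(1) by auto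
    have "z < d" using z(2) d(1) by linarith
    then have "0 < f' z" using d(2)[of z] z(1) 0 by simp
    then have "0 < (d / 2 - 0) * f' z" using d(1) by simp
    then show False using max[of "d / 2"] d(1) unfolding z(3)[symmetric] by linarith
  qed
qed

definition substochastic :: "real^'n^'n \<Rightarrow> bool" where
  "substochastic A \<longleftrightarrow> (\<forall>i j. 0 \<le> A $ i $ j) \<and> (\<forall>i. (\<Sum>j\<in>UNIV. A $ i $ j) \<le> 1)"

text \<open>Rows may sum to less than 1, so the bound rests on \<open>0 \<le> m\<close>.\<close>

lemma substochastic_le_max:
  assumes "substochastic A" "\<And>j. v $ j \<le> m" "0 \<le> m"
  shows "(A *v v) $ i \<le> m"
proof -
  have "(A *v v) $ i \<le> (\<Sum>j\<in>UNIV. A $ i $ j * m)"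
    unfolding matrix_vector_mult_def using assms
    by (auto simp: substochastic_def intro!: sum_mono mult_left_mono)
  also have "\<dots> = (\<Sum>j\<in>UNIV. A $ i $ j) * m" by (simp add: sum_distrib_right)
  also have "\<dots> \<le> 1 * m" using assms by (intro mult_right_mono) (auto simp: substochastic_def)
  finally show ?thesis by simp
qed

text \<open>The \<open>i\<close>-th entry of \<open>mat_exp (t *\<^sub>R L) *v v\<close> is largest
  at \<open>t = 0\<close> among all \<open>t \<ge> 0\<close>; its first two derivatives at 0 are the
  entries in the conclusion.\<close>

lemma substochastic_semigroup_max:
  fixes L :: "real^'n^'n"
  assumes sub: "\<And>t. 0 \<le> t \<Longrightarrow> substochastic (mat_exp (t *\<^sub>R L))"
    and v: "\<And>j. v $ j \<le> v $ i" "0 \<le> v $ i"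
  shows "(L *v v) $ i \<le> 0" "(L *v v) $ i = 0 \<Longrightarrow> (L *v (L *v v)) $ i \<le> 0"
proof -
  \<comment> \<open>The free left factor \<open>B\<close> lets one rule differentiate both the
    function (\<open>B = mat 1\<close>) and its derivative (\<open>B = L\<close>).\<close>
  have bl: "bounded_linear (\<lambda>A :: real^'n^'n. (B ** A *v v) $ i)" for B :: "real^'n^'n"
    unfolding linear_conv_bounded_linear[symmetric] linear_iff
    by (auto simp: mm_simps matrix_vector_mult_add_rdistrib scaleR_matrix_vector_assoc[symmetric])
  have der: "((\<lambda>t. (B ** mat_exp (t *\<^sub>R L) *v v) $ i) has_real_derivative (B ** (L ** mat_exp (t *\<^sub>R L)) *v v) $ i) (at t)" for B t
    unfolding has_real_derivative_iff_has_vector_derivative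
    by (rule bounded_linear.has_vector_derivative[OF bl mat_exp_deriv])
  let ?f = "\<lambda>t. (mat 1 ** mat_exp (t *\<^sub>R L) *v v) $ i" and ?g = "\<lambda>t. (L ** mat_exp (t *\<^sub>R L) *v v) $ i"
  have f: "(?f has_real_derivative ?g t) (at t)" for t using der[of "mat 1" t] by simp
  have g: "(?g has_real_derivative (L *v (L *v v)) $ i) (at 0)"
    using der[of L 0] by (simp add: mat_exp_0 matrix_vector_mul_assoc)
  have max: "?f t \<le> ?f 0" if "0 \<le> t" for t
    using substochastic_le_max[OF sub[OF that] v] by (simp add: mat_exp_0)
  show "(L *v v) $ i \<le> 0" "(L *v v) $ i = 0 \<Longrightarrow> (L *v (L *v v)) $ i \<le> 0"
    using deriv_at_right_max[OF f g max] by (simp_all add: mat_exp_0)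
qed

section \<open>First-passage transforms are substochastic\<close>

lemma first_passage_transform_nonneg: "0 \<le> first_passage_transform M X J q x j"
  unfolding first_passage_transform_def by (intro integral_nonneg_AE) auto

lemma first_passage_transform_sum_le_1:
  fixes J :: "real \<Rightarrow> 'w \<Rightarrow> 'n::finite"
  assumes "prob_space M" "0 \<le> q"
  shows "(\<Sum>j\<in>UNIV. first_passage_transform M X J q x j) \<le> 1"
proof -
  interpret prob_space M by fact
  define g where "g j \<omega> = (if hitting_times X x \<omega> \<noteq> {} \<and> J (Inf (hitting_times X x \<omega>)) \<omega> = j
                  then exp (- q * Inf (hitting_times X x \<omega>)) else 0)" for j \<omega>
  \<comment> \<open>The integral of a non-integrable function is 0 by convention, so restricting to
    \<open>I\<close> preserves the sum and allows its exchange with the integral.\<close>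
  define I where "I = {j. integrable M (g j)}"
  have "(\<Sum>j\<in>UNIV. first_passage_transform M X J q x j) = (\<Sum>j\<in>I. \<integral>\<omega>. g j \<omega> \<partial>M)"
    unfolding first_passage_transform_def g_def[symmetric]
    by (rule sum.mono_neutral_right) (auto simp: I_def not_integrable_integral_eq)
  also have "\<dots> = (\<integral>\<omega>. (\<Sum>j\<in>I. g j \<omega>) \<partial>M)"
    by (rule Bochner_Integration.integral_sum[symmetric]) (auto simp: I_def)
  also have "\<dots> \<le> (\<integral>\<omega>. 1 \<partial>M)"
  proof (rule integral_mono)
    show "integrable M (\<lambda>\<omega>. \<Sum>j\<in>I. g j \<omega>)" by (auto simp: I_def)
    fix \<omega>
    let ?h = "hitting_times X x \<omega>"
    have "(\<Sum>j\<in>I. g j \<omega>) \<le> (\<Sum>j\<in>UNIV. g j \<omega>)"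
      by (rule sum_mono2) (auto simp: g_def)
    \<comment> \<open>For each path only the state occupied at the passage time contributes.\<close>
    also have "\<dots> = (if ?h \<noteq> {} then exp (- q * Inf ?h) else 0)"
      by (auto simp: g_def)
    also have "\<dots> \<le> 1"
      using \<open>0 \<le> q\<close> by (auto intro!: mult_nonneg_nonneg cInf_greatest simp: hitting_times_def less_imp_le)
    finally show "(\<Sum>j\<in>I. g j \<omega>) \<le> 1" .
  qed auto
  finally show ?thesis by (simp add: prob_space)
qed

text \<open>The only place where the first-passage identity enters; all other arguments use the
  quadratic equation.\<close>

lemma first_passage_rate_matrix_substochastic:
  fixes \<Lambda> :: "real^'n^'n"
  assumes "first_passage_rate_matrix Q \<mu> \<sigma> P X J s q \<Lambda>" "\<And>i. prob_space (P i)" "0 \<le> q" "0 \<le> t"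
  shows "substochastic (mat_exp (t *\<^sub>R \<Lambda>))"
proof -
  have *: "mat_exp (t *\<^sub>R \<Lambda>) $ i $ j = first_passage_transform (P i) (\<lambda>t \<omega>. s * X t \<omega>) J q t j" for i j
    using assms unfolding first_passage_rate_matrix_def by auto
  show ?thesis
    unfolding substochastic_def *
    by (intro conjI allI first_passage_transform_nonneg first_passage_transform_sum_le_1 assms)
qed

lemma diag_mat_mult_vec: "(diag_mat d *v v) $ i = d $ i * v $ i"
  by (simp add: diag_mat_def matrix_vector_mult_def if_distrib[of "\<lambda>x. x * _"] cong: if_cong)

text \<open>For \<open>v\<close> in the kernel, \<open>t \<mapsto> exp (t \<Lambda>m) v\<close> and \<open>t \<mapsto> exp (- t \<Lambda>p) v\<close> join at \<open>0\<close> to a solution of the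
  differential equation on the whole line that attains its maximum at \<open>0\<close>, which the maximum
  principle forbids when \<open>q > 0\<close>.\<close>

lemma first_passage_sum_invertible:
  fixes Q :: "real^'n^'n"
  assumes Q: "transition_rate_matrix Q" and "\<And>i. prob_space (P i)" and "0 < q"
    and Lp: "first_passage_rate_matrix Q \<mu> \<sigma> P X J 1 q \<Lambda>p"
    and Lm: "first_passage_rate_matrix Q \<mu> \<sigma> P X J (-1) q \<Lambda>m"
  shows "invertible (\<Lambda>p + \<Lambda>m)"
proof -
  have no: False if v: "(\<Lambda>p + \<Lambda>m) *v v = 0" "\<And>j. v $ j \<le> v $ i" "0 < v $ i" for v i
  proof -
    have sp: "substochastic (mat_exp (t *\<^sub>R \<Lambda>p))" "substochastic (mat_exp (t *\<^sub>R \<Lambda>m))" if "0 \<le> t" for t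
      using first_passage_rate_matrix_substochastic[OF Lp] first_passage_rate_matrix_substochastic[OF Lm] assms that by auto
    have p: "(\<Lambda>p *v v) $ i \<le> 0"
      by (rule substochastic_semigroup_max(1)) (use sp v in auto)
    have m: "(\<Lambda>m *v v) $ i \<le> 0"
      by (rule substochastic_semigroup_max(1)) (use sp v in auto)
    \<comment> \<open>Two nonpositive numbers with sum 0 both vanish, which opens the second-order
      case for \<open>\<Lambda>m\<close>.\<close>
    have "(\<Lambda>p *v v) $ i + (\<Lambda>m *v v) $ i = 0"
      using arg_cong[OF v(1), of "\<lambda>w. w $ i"] by (simp add: matrix_vector_mult_add_rdistrib)
    then have m0: "(\<Lambda>m *v v) $ i = 0" using p m by linarith
    have m2: "(\<Lambda>m *v (\<Lambda>m *v v)) $ i \<le> 0"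
      by (rule substochastic_semigroup_max(2)) (use sp v m0 in auto)
    have "(diag_mat (\<chi> i. (\<sigma> $ i)\<^sup>2 / 2) ** (\<Lambda>m ** \<Lambda>m) + diag_mat \<mu> ** \<Lambda>m + (Q - q *\<^sub>R mat 1)) *v v = 0"
      using Lm unfolding first_passage_rate_matrix_def by simp
    from arg_cong[OF this, of "\<lambda>w. w $ i"]
    have "(\<sigma> $ i)\<^sup>2 / 2 * (\<Lambda>m *v (\<Lambda>m *v v)) $ i + \<mu> $ i * (\<Lambda>m *v v) $ i + (Q *v v) $ i - q * v $ i = 0"
      by (simp add: matrix_vector_mult_add_rdistrib matrix_vector_mult_diff_rdistrib
          matrix_vector_mul_assoc[symmetric] diag_mat_mult_vec scaleR_matrix_vector_assoc[symmetric])
    moreover have "(\<sigma> $ i)\<^sup>2 / 2 * (\<Lambda>m *v (\<Lambda>m *v v)) $ i \<le> 0"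
      using m2 by (intro mult_nonneg_nonpos) auto
    moreover have "(Q *v v) $ i \<le> 0"
    proof -
      have "(Q *v v) $ i \<le> (\<Sum>j\<in>UNIV. Q $ i $ j * v $ i)"
        unfolding matrix_vector_mult_def
      proof (simp, rule sum_mono)
        show "Q $ i $ j * v $ j \<le> Q $ i $ j * v $ i" for j
          using Q v(2)[of j] by (cases "j = i") (auto simp: transition_rate_matrix_def intro!: mult_left_mono)
      qed
      also have "\<dots> = 0" using Q by (simp add: transition_rate_matrix_def sum_distrib_right[symmetric])
      finally show ?thesis .
    qed
    \<comment> \<open>The drift term is 0 and the diffusion and \<open>Q\<close> terms are
      nonpositive, so nothing balances a positive killing term.\<close>
    ultimately have "q * v $ i \<le> 0" using m0 by simp
    then show False using v(3) \<open>0 < q\<close> by (simp add: mult_le_0_iff)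
  qed
  have "v = 0" if v: "(\<Lambda>p + \<Lambda>m) *v v = 0" for v
  proof (rule ccontr)
    assume "v \<noteq> 0"
    then obtain k where k: "v $ k \<noteq> 0" by (auto simp: vec_eq_iff)
    \<comment> \<open>At an index where the absolute value is largest, either \<open>v\<close> or
      \<open>- v\<close> has a positive maximal entry.\<close>
    have "Max (range (\<lambda>j. \<bar>v $ j\<bar>)) \<in> range (\<lambda>j. \<bar>v $ j\<bar>)"
      by (intro Max_in) auto
    then obtain i where i_max: "Max (range (\<lambda>j. \<bar>v $ j\<bar>)) = \<bar>v $ i\<bar>" by blast
    have i: "\<bar>v $ j\<bar> \<le> \<bar>v $ i\<bar>" for j
      unfolding i_max[symmetric] by (intro Max_ge) auto
    have "v $ i \<noteq> 0" using k i[of k] by auto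
    then consider "0 < v $ i" | "0 < (- v) $ i" by fastforce
    then show False
    proof cases
      case 1
      then have "v $ j \<le> v $ i" for j using i[of j] by auto
      then show False using no[OF v] 1 by blast
    next
      case 2
      have "(\<Lambda>p + \<Lambda>m) *v (- v) = 0"
        using v by (simp add: matrix_vector_mult_def vec_eq_iff sum_negf)
      moreover have "(- v) $ j \<le> (- v) $ i" for j using i[of j] 2 by auto
      ultimately show False using no 2 by blast
    qed
  qed
  then obtain B where "B ** (\<Lambda>p + \<Lambda>m) = mat 1"
    using matrix_left_invertible_ker[of "\<Lambda>p + \<Lambda>m"] by blast
  then show ?thesis
    unfolding invertible_def using matrix_left_right_inverse by blast
qed

section \<open>The renewal equation\<close>

lemma matrix_inv_mult:
  assumes "invertible (A :: real^'n^'n)"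
  shows "A ** matrix_inv A = mat 1" "matrix_inv A ** A = mat 1"
  using assms someI_ex[of "\<lambda>B. A ** B = mat 1 \<and> B ** A = mat 1"]
  unfolding invertible_def matrix_inv_def by auto

lemma has_vector_derivative_reflect:
  assumes "\<And>t. (f has_vector_derivative f' t) (at t)"
  shows "((\<lambda>z. f (x - z)) has_vector_derivative - f' (x - z)) (at (z::real))"
proof -
  have "((\<lambda>z. x - z) has_vector_derivative -1) (at z)"
    by (auto intro!: derivative_eq_intros)
  from vector_diff_chain_at[OF this assms] show ?thesis by (simp add: o_def)
qed

lemma has_vector_derivative_translate:
  assumes "\<And>t. (f has_vector_derivative f' t) (at t)"
  shows "((\<lambda>z. f (z - x)) has_vector_derivative f' (z - x)) (at (z::real))"
proof -
  have "((\<lambda>z. z - x) has_vector_derivative 1) (at z)"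
    by (auto intro!: derivative_eq_intros)
  from vector_diff_chain_at[OF this assms] show ?thesis by (simp add: o_def)
qed

lemma mat_exp_uminus_deriv:
  "((\<lambda>x. mat_exp (- x *\<^sub>R A)) has_vector_derivative - (A ** mat_exp (- x *\<^sub>R A))) (at x)"
  using has_vector_derivative_reflect[of "\<lambda>x. mat_exp (x *\<^sub>R A)" "\<lambda>x. A ** mat_exp (x *\<^sub>R A)" 0 x, OF mat_exp_deriv]
  by simp

lemma diag_mat_mult: "diag_mat a ** diag_mat b = diag_mat (\<chi> i. a $ i * b $ i)"
  by (simp add: diag_mat_def matrix_matrix_mult_def vec_eq_iff if_distrib[of "\<lambda>x. x * _"]
      if_distrib[of "\<lambda>x. _ * x"] cong: if_cong)

lemma diag_mat_1: "diag_mat (\<chi> i. 1) = mat 1"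
  by (simp add: diag_mat_def mat_def vec_eq_iff)

text \<open>The transform of the series is a left inverse of the Laplace exponent shifted by
  \<open>q\<close>, hence its inverse, and transforms determine continuous functions. This also
  makes \<open>W\<close> smooth, where \<open>scale_matrix\<close> asks only for continuity.\<close>

lemma scale_matrix_eq_scale_sol:
  fixes Q :: "real^'n^'n" and \<sigma> \<mu> :: "real^'n"
  assumes G: "G ** diag_mat (\<chi> i. (\<sigma> $ i)\<^sup>2 / 2) = mat 1"
    and W: "scale_matrix Q \<mu> \<sigma> q W" and "0 \<le> x"
  shows "W x = scale_sol G (diag_mat \<mu>) (Q - q *\<^sub>R mat 1) x"
proof (rule laplace_unique)
  let ?U = "scale_sol G (diag_mat \<mu>) (Q - q *\<^sub>R mat 1)"
  show "continuous_on {0..} W" using W by (simp add: scale_matrix_def)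
  show "continuous_on {0..} ?U"
    using scale_sol_deriv by (intro continuous_at_imp_continuous_on ballI has_vector_derivative_continuous)
  have F: "matrix_laplace_exponent Q \<mu> \<sigma> \<alpha> - q *\<^sub>R mat 1
     = \<alpha>\<^sup>2 *\<^sub>R diag_mat (\<chi> i. (\<sigma> $ i)\<^sup>2 / 2) + \<alpha> *\<^sub>R diag_mat \<mu> + (Q - q *\<^sub>R mat 1)" for \<alpha>
    by (auto simp: matrix_laplace_exponent_def vec_eq_iff diag_mat_def)
  have *: "\<forall>\<^sub>F \<alpha> in at_top. invertible (matrix_laplace_exponent Q \<mu> \<sigma> \<alpha> - q *\<^sub>R mat 1) \<and>
        set_integrable lborel {0..} (\<lambda>x. exp (- \<alpha> * x) *\<^sub>R W x) \<and>
        (LINT x:{0..}|lborel. exp (- \<alpha> * x) *\<^sub>R W x)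
          = matrix_inv (matrix_laplace_exponent Q \<mu> \<sigma> \<alpha> - q *\<^sub>R mat 1)"
    using W by (simp add: scale_matrix_def)
  show "\<forall>\<^sub>F \<alpha> in at_top. set_integrable lborel {0..} (\<lambda>x. exp (- \<alpha> * x) *\<^sub>R W x) \<and>
      set_integrable lborel {0..} (\<lambda>x. exp (- \<alpha> * x) *\<^sub>R ?U x) \<and>
      (LINT x:{0..}|lborel. exp (- \<alpha> * x) *\<^sub>R W x) = (LINT x:{0..}|lborel. exp (- \<alpha> * x) *\<^sub>R ?U x)"
    using * scale_sol_laplace[OF G, of "diag_mat \<mu>" "Q - q *\<^sub>R mat 1"]
  proof eventually_elim
    case (elim \<alpha>)
    let ?F = "matrix_laplace_exponent Q \<mu> \<sigma> \<alpha> - q *\<^sub>R mat 1"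
    let ?I = "LINT x:{0..}|lborel. exp (- \<alpha> * x) *\<^sub>R ?U x"
    have "?I ** ?F = mat 1" "?F ** matrix_inv ?F = mat 1"
      using elim matrix_inv_mult(1)[of ?F] by (simp_all only: F)
    then have "?I = matrix_inv ?F"
      using matrix_mul_assoc[of ?I ?F "matrix_inv ?F"] by simp
    then show ?case using elim by simp
  qed
qed fact

text \<open>Feeding the bound into the equation repeatedly improves it to
  \<open>B * ((C * (x - y)) ^ n / fact n)\<close>, which tends to 0 as \<open>n\<close>
  grows.\<close>

lemma volterra_zero:
  fixes E :: "real \<Rightarrow> 'a::euclidean_space"
  assumes bd: "\<And>x. y \<le> x \<Longrightarrow> x \<le> b \<Longrightarrow> norm (E x) \<le> B" and "0 \<le> C"
    and int: "\<And>x. y \<le> x \<Longrightarrow> x \<le> b \<Longrightarrow> set_integrable lborel {y..x} (k x)"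
    and eq: "\<And>x. y \<le> x \<Longrightarrow> x \<le> b \<Longrightarrow> E x = (LINT z:{y..x}|lborel. k x z)"
    and le: "\<And>x z. y \<le> z \<Longrightarrow> z \<le> x \<Longrightarrow> x \<le> b \<Longrightarrow> norm (k x z) \<le> C * norm (E z)"
    and x: "y \<le> x" "x \<le> b"
  shows "E x = 0"
proof -
  have bound: "norm (E x) \<le> B * ((C * (x - y)) ^ n / fact n)" if "y \<le> x" "x \<le> b" for x n
    using that
  proof (induction n arbitrary: x)
    case 0
    then show ?case using bd by simp
  next
    case (Suc n)
    let ?g = "\<lambda>z. C * (B * ((C * (z - y)) ^ n / fact n))"
    let ?G = "\<lambda>z. B * ((C * (z - y)) ^ Suc n / fact (Suc n))"
    have contg: "continuous_on {y..x} ?g" by (intro continuous_intros) auto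
    have "norm (E x) \<le> (LINT z:{y..x}|lborel. norm (k x z))"
      using eq int Suc.prems set_integral_norm_bound by metis
    also have "\<dots> \<le> (LINT z:{y..x}|lborel. ?g z)"
    proof (rule set_integral_mono)
      show "set_integrable lborel {y..x} (\<lambda>z. norm (k x z))"
        by (intro set_integrable_norm int Suc.prems)
      show "set_integrable lborel {y..x} ?g"
        by (rule borel_integrable_atLeastAtMost'[OF contg])
      show "norm (k x z) \<le> ?g z" if "z \<in> {y..x}" for z
        by (rule order_trans[OF le mult_left_mono[OF Suc.IH \<open>0 \<le> C\<close>]]) (use Suc.prems that in auto)
    qed
    also have "\<dots> = ?G x - ?G y"
      unfolding set_lebesgue_integral_def
    proof (rule integral_FTC_atLeastAtMost[OF Suc.prems(1) _ contg])
      fix z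
      have "((\<lambda>z. C * (z - y)) has_real_derivative C) (at z within {y..x})"
        by (auto intro!: derivative_eq_intros)
      note D = DERIV_cmult[OF DERIV_cdivide[OF DERIV_power_Suc[OF this, of n], of "fact (Suc n)"], of B]
      have "fact (Suc n) = (1 + real n) * fact n" "1 + real n \<noteq> 0" by simp_all
      then have "(1 + real n) * w / fact (Suc n) = w / fact n" for w :: real
        by (simp only: nonzero_mult_divide_mult_cancel_left not_False_eq_True)
      then show "(?G has_vector_derivative ?g z) (at z within {y..x})"
        unfolding has_real_derivative_iff_has_vector_derivative[symmetric]
        by (intro DERIV_cong[OF D]) (simp only:, simp)
    qed
    finally show ?case by simp
  qed
  have "(\<lambda>n. (C * (x - y)) ^ n / fact n) \<longlonglongrightarrow> 0"
    using summable_LIMSEQ_zero[OF summable_exp[of "C * (x - y)"]] by (simp add: field_simps)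
  then have "(\<lambda>n. B * ((C * (x - y)) ^ n / fact n)) \<longlonglongrightarrow> B * 0"
    by (intro tendsto_intros)
  then have "norm (E x) \<le> 0"
    using bound[OF x] by (intro LIMSEQ_le_const) auto
  then show ?thesis by simp
qed

text \<open>The right differential equation of \<open>scale_sol G M Q\<close> cancels all terms of the derivative of
  the antiderivative below but \<open>U(x - z) (D Z'' + M Z' + Q Z)(z)\<close>.\<close>

lemma scale_sol_integral:
  fixes Z Z' Z'' :: "real \<Rightarrow> real^'n^'n" and x :: real
  assumes "G ** D = mat 1"
    and Z: "\<And>z. (Z has_vector_derivative Z' z) (at z)" "\<And>z. (Z' has_vector_derivative Z'' z) (at z)"
    and ode: "\<And>z. D ** Z'' z + M ** Z' z + (Q - p *\<^sub>R mat 1) ** Z z = 0"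
    and "a \<le> b"
  defines "H \<equiv> \<lambda>z. scale_sol G M Q (x - z) ** (D ** Z' z + M ** Z z) + scale_sol' G M Q (x - z) ** (D ** Z z)"
  shows "((\<lambda>z. p *\<^sub>R (scale_sol G M Q (x - z) ** Z z)) has_integral H b - H a) {a..b}"
proof (rule fundamental_theorem_of_calculus[OF \<open>a \<le> b\<close>])
  fix z
  let ?U = "scale_sol G M Q (x - z)" and ?U' = "scale_sol' G M Q (x - z)" and ?U'' = "scale_sol'' G M Q (x - z)"
  note dU = has_vector_derivative_reflect[OF scale_sol_deriv, of G M Q x z]
    has_vector_derivative_reflect[OF scale_sol'_deriv, of G M Q x z]
  note lin = bounded_linear.has_vector_derivative[OF mm.bounded_linear_right]
  have "(H has_vector_derivative
      (?U ** (D ** Z'' z + M ** Z' z) + (- ?U') ** (D ** Z' z + M ** Z z)) +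
      (?U' ** (D ** Z' z) + (- ?U'') ** (D ** Z z))) (at z)"
    unfolding H_def
    by (intro has_vector_derivative_add mm.has_vector_derivative dU lin Z)
  \<comment> \<open>The equation of \<open>Z\<close> turns the surviving factor into
    \<open>p *\<^sub>R Z z\<close>.\<close>
  moreover have "D ** Z'' z + M ** Z' z = p *\<^sub>R Z z - Q ** Z z"
    using ode[of z] by (simp add: mm_simps algebra_simps eq_neg_iff_add_eq_0)
  moreover have "?U'' ** D = - (?U' ** M) - ?U ** Q"
    using scale_sol_ode_right[OF assms(1), of M Q "x - z"] by (simp add: algebra_simps eq_neg_iff_add_eq_0)
  then have "?U'' ** (D ** Z z) = (- (?U' ** M) - ?U ** Q) ** Z z"
    by (simp add: matrix_mul_assoc)
  ultimately have "(H has_vector_derivative p *\<^sub>R (?U ** Z z)) (at z)"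
    by (simp add: mm_simps)
  then show "(H has_vector_derivative p *\<^sub>R (?U ** Z z)) (at z within {a..b})"
    by (rule has_vector_derivative_at_within)
qed

text \<open>The factor in front of \<open>W(x\<^sub>1 - y)\<close> is the solution of \<open>D A'' + M A' + (Q - q) A = 0\<close> with
  \<open>A(0) = 1\<close>, \<open>A'(0) = 0\<close>.\<close>

lemma first_passage_fundamental_solution:
  fixes Q :: "real^'n^'n" and \<sigma> \<mu> :: "real^'n" and \<Lambda>p \<Lambda>m :: "real^'n^'n"
  assumes Lp: "first_passage_rate_matrix Q \<mu> \<sigma> P X J 1 q \<Lambda>p"
    and Lm: "first_passage_rate_matrix Q \<mu> \<sigma> P X J (-1) q \<Lambda>m"
    and inv: "invertible (\<Lambda>p + \<Lambda>m)"
    and A: "A = (\<lambda>t. mat_exp (- t *\<^sub>R \<Lambda>p) ** matrix_inv (\<Lambda>p + \<Lambda>m) ** \<Lambda>m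
               + mat_exp (t *\<^sub>R \<Lambda>m) ** matrix_inv (\<Lambda>p + \<Lambda>m) ** \<Lambda>p)"
  obtains A' A'' where "\<And>t. (A has_vector_derivative A' t) (at t)"
    "\<And>t. (A' has_vector_derivative A'' t) (at t)"
    "\<And>t. diag_mat (\<chi> i. (\<sigma> $ i)\<^sup>2 / 2) ** A'' t + diag_mat \<mu> ** A' t + (Q - q *\<^sub>R mat 1) ** A t = 0"
    "A 0 = mat 1" "A' 0 = 0"
proof -
  define Ep where "Ep t = mat_exp (- t *\<^sub>R \<Lambda>p)" for t
  define Em where "Em t = mat_exp (t *\<^sub>R \<Lambda>m)" for t
  define Si where "Si = matrix_inv (\<Lambda>p + \<Lambda>m)"
  define D where "D = diag_mat (\<chi> i. (\<sigma> $ i)\<^sup>2 / 2)"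
  define M where "M = diag_mat \<mu>"
  define R where "R = Q - q *\<^sub>R mat 1"
  have Ep: "(Ep has_vector_derivative - (\<Lambda>p ** Ep t)) (at t)" for t
    unfolding Ep_def by (rule mat_exp_uminus_deriv)
  have Em: "(Em has_vector_derivative \<Lambda>m ** Em t) (at t)" for t
    unfolding Em_def by (rule mat_exp_deriv)
  have A_def: "A t = Ep t ** (Si ** \<Lambda>m) + Em t ** (Si ** \<Lambda>p)" for t
    by (simp add: A Ep_def Em_def Si_def matrix_mul_assoc)
  \<comment> \<open>The rate matrices are kept to the left of the exponentials, so that
    \<open>D\<close>, \<open>M\<close> and \<open>R\<close> meet them directly and the two quadratic
    equations factor out.\<close>
  define A' where "A' t = - (\<Lambda>p ** (Ep t ** (Si ** \<Lambda>m))) + \<Lambda>m ** (Em t ** (Si ** \<Lambda>p))" for t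
  define A'' where "A'' t = \<Lambda>p ** (\<Lambda>p ** (Ep t ** (Si ** \<Lambda>m))) + \<Lambda>m ** (\<Lambda>m ** (Em t ** (Si ** \<Lambda>p)))" for t
  note left = bounded_linear.has_vector_derivative[OF mm.bounded_linear_left]
  note right = bounded_linear.has_vector_derivative[OF mm.bounded_linear_right]
  have "(A has_vector_derivative A' t) (at t)" for t
    using has_vector_derivative_add[OF left[OF Ep, of "Si ** \<Lambda>m" t] left[OF Em, of "Si ** \<Lambda>p" t]]
    unfolding A_def[abs_def] A'_def by (simp add: mm_simps)
  moreover have "(A' has_vector_derivative A'' t) (at t)" for t
    using has_vector_derivative_add[OF has_vector_derivative_minus[OF right[OF left[OF Ep, of "Si ** \<Lambda>m" t], of \<Lambda>p]]
        right[OF left[OF Em, of "Si ** \<Lambda>p" t], of \<Lambda>m]]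
    unfolding A'_def[abs_def] A''_def by (simp add: mm_simps)
  moreover have "D ** A'' t + M ** A' t + R ** A t = 0" for t
  proof -
    have p: "D ** (\<Lambda>p ** \<Lambda>p) - M ** \<Lambda>p + R = 0" and m: "D ** (\<Lambda>m ** \<Lambda>m) + M ** \<Lambda>m + R = 0"
      using Lp Lm by (simp_all add: first_passage_rate_matrix_def D_def M_def R_def)
    have "D ** A'' t + M ** A' t + R ** A t
      = (D ** (\<Lambda>p ** \<Lambda>p) - M ** \<Lambda>p + R) ** (Ep t ** (Si ** \<Lambda>m))
        + (D ** (\<Lambda>m ** \<Lambda>m) + M ** \<Lambda>m + R) ** (Em t ** (Si ** \<Lambda>p))"
      by (simp add: A_def A'_def A''_def mm_simps)
    then show ?thesis by (simp add: p m mm.zero_left)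
  qed
  moreover have "A 0 = mat 1"
  proof -
    have "A 0 = Si ** (\<Lambda>p + \<Lambda>m)"
      by (simp add: A_def Ep_def Em_def mat_exp_0 mm_simps add.commute)
    then show ?thesis using matrix_inv_mult[OF inv] by (simp add: Si_def)
  qed
  moreover have "A' 0 = 0"
  proof -
    \<comment> \<open>Expanding \<open>\<Lambda>p\<close> once with the sum and its inverse on the
      left and once on the right, then cancelling \<open>\<Lambda>p ** (Si ** \<Lambda>p)\<close>,
      shows that the two parts of \<open>A' 0\<close> cancel.\<close>
    have "(\<Lambda>p + \<Lambda>m) ** (Si ** \<Lambda>p) = \<Lambda>p" "Si ** (\<Lambda>p + \<Lambda>m) = mat 1"
      using matrix_inv_mult[OF inv] by (simp_all add: Si_def matrix_mul_assoc)
    then have "\<Lambda>p ** (Si ** \<Lambda>p) + \<Lambda>m ** (Si ** \<Lambda>p) = \<Lambda>p" "\<Lambda>p ** (Si ** (\<Lambda>p + \<Lambda>m)) = \<Lambda>p"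
      by (simp_all add: mm.add_left)
    then show ?thesis
      by (simp add: A'_def Ep_def Em_def mat_exp_0 mm.add_right) (metis add_left_cancel)
  qed
  ultimately show ?thesis using that unfolding D_def M_def R_def by blast
qed

text \<open>The difference of two bounded solutions solves the homogeneous Volterra equation, with
  kernel constant built from the bounds on \<open>\<omega>\<close>, on \<open>W\<close> and on
  matrix multiplication.\<close>

lemma omega_scale_matrix_unique:
  fixes W :: "real \<Rightarrow> real^'n^'n"
  assumes V: "omega_scale_matrix W \<omega> V"
    and W: "bounded (W ` {0..b - y})"
    and \<omega>: "\<And>z. \<bar>\<omega> z\<bar> \<le> c"
    and Z: "bounded (Z ` {y..b})"
    and intZ: "\<And>x. y \<le> x \<Longrightarrow> x \<le> b \<Longrightarrow> set_integrable lborel {y..x} (\<lambda>z. \<omega> z *\<^sub>R (W (x - z) ** Z z))"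
    and eqZ: "\<And>x. y \<le> x \<Longrightarrow> x \<le> b \<Longrightarrow> Z x = W (x - y) + (LINT z:{y..x}|lborel. \<omega> z *\<^sub>R (W (x - z) ** Z z))"
    and x: "y \<le> x" "x \<le> b"
  shows "V x y = Z x"
proof -
  obtain C where C: "C > 0" "\<And>a b. norm (a ** b) \<le> norm (a::real^'n^'n) * norm (b::real^'n^'n) * C"
    using mm.pos_bounded by blast
  obtain BW where BW: "\<And>t. 0 \<le> t \<Longrightarrow> t \<le> b - y \<Longrightarrow> norm (W t) \<le> BW"
    using W unfolding bounded_iff by (metis atLeastAtMost_iff imageI)
  obtain BZ where BZ: "\<And>t. y \<le> t \<Longrightarrow> t \<le> b \<Longrightarrow> norm (Z t) \<le> BZ"
    using Z unfolding bounded_iff by (metis atLeastAtMost_iff imageI)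
  have "bounded ((\<lambda>x. V x y) ` {y..b})" using V unfolding omega_scale_matrix_def by blast
  then obtain BV where BV: "\<And>t. y \<le> t \<Longrightarrow> t \<le> b \<Longrightarrow> norm (V t y) \<le> BV"
    unfolding bounded_iff by (metis (no_types, lifting) atLeastAtMost_iff imageI)
  have intV: "set_integrable lborel {y..x} (\<lambda>z. \<omega> z *\<^sub>R (W (x - z) ** V z y))"
    and eqV: "V x y = W (x - y) + (LINT z:{y..x}|lborel. \<omega> z *\<^sub>R (W (x - z) ** V z y))" if "y \<le> x" for x
    using V that unfolding omega_scale_matrix_def by blast+
  have diff: "\<omega> z *\<^sub>R (W (x - z) ** (V z y - Z z)) = \<omega> z *\<^sub>R (W (x - z) ** V z y) - \<omega> z *\<^sub>R (W (x - z) ** Z z)" for x z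
    by (simp add: mm.diff_right scaleR_diff_right)
  have nn: "0 \<le> c" "0 \<le> BW"
    using order_trans[OF abs_ge_zero \<omega>] order_trans[OF norm_ge_zero BW[of 0]] x by auto
  have "V x y - Z x = 0"
  proof (rule volterra_zero[where E = "\<lambda>x. V x y - Z x" and y = y and b = b and C = "c * (BW * C)"
        and k = "\<lambda>x z. \<omega> z *\<^sub>R (W (x - z) ** (V z y - Z z))" and B = "BV + BZ"])
    show "norm (V x y - Z x) \<le> BV + BZ" if "y \<le> x" "x \<le> b" for x
      using norm_triangle_ineq4[of "V x y" "Z x"] BV[OF that] BZ[OF that] by linarith
    show "0 \<le> c * (BW * C)" using nn C(1) by simp
    show "set_integrable lborel {y..x} (\<lambda>z. \<omega> z *\<^sub>R (W (x - z) ** (V z y - Z z)))" if "y \<le> x" "x \<le> b" for x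
      unfolding diff by (intro set_integral_diff(1) intV intZ that)
    show "V x y - Z x = (LINT z:{y..x}|lborel. \<omega> z *\<^sub>R (W (x - z) ** (V z y - Z z)))" if "y \<le> x" "x \<le> b" for x
      unfolding diff set_integral_diff(2)[OF intV[OF that(1)] intZ[OF that]]
      using eqV[OF that(1)] eqZ[OF that] by (simp add: algebra_simps)
    show "norm (\<omega> z *\<^sub>R (W (x - z) ** (V z y - Z z))) \<le> c * (BW * C) * norm (V z y - Z z)"
      if "y \<le> z" "z \<le> x" "x \<le> b" for x z
    proof -
      have "norm (W (x - z) ** (V z y - Z z)) \<le> norm (W (x - z)) * norm (V z y - Z z) * C"
        by (rule C(2))
      also have "\<dots> \<le> BW * norm (V z y - Z z) * C"
        using BW[of "x - z"] that C(1) by (intro mult_right_mono) auto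
      finally have "\<bar>\<omega> z\<bar> * norm (W (x - z) ** (V z y - Z z)) \<le> c * (BW * norm (V z y - Z z) * C)"
        using \<omega>[of z] nn by (intro mult_mono) auto
      then show ?thesis by (simp add: mult_ac)
    qed
  qed (use x in auto)
  then show ?thesis by simp
qed

text \<open>At \<open>x1\<close> the boundary terms of \<open>scale_sol_integral\<close> for \<open>Z\<close> and \<open>Y\<close> agree, so they telescope.\<close>

lemma renewal_two_pieces:
  fixes Z Z' Z'' Y Y' Y'' :: "real \<Rightarrow> real^'n^'n"
  assumes GD: "G ** D = mat 1" "D ** G = mat 1"
    and W: "\<And>t. 0 \<le> t \<Longrightarrow> W t = scale_sol G M Q t"
    and Z: "\<And>z. (Z has_vector_derivative Z' z) (at z)" "\<And>z. (Z' has_vector_derivative Z'' z) (at z)"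
      "\<And>z. D ** Z'' z + M ** Z' z + (Q - p0 *\<^sub>R mat 1) ** Z z = 0"
    and Y: "\<And>z. (Y has_vector_derivative Y' z) (at z)" "\<And>z. (Y' has_vector_derivative Y'' z) (at z)"
      "\<And>z. D ** Y'' z + M ** Y' z + (Q - p1 *\<^sub>R mat 1) ** Y z = 0"
    and init: "Z y = 0" "Z' y = G" and match: "Y x1 = Z x1" "Y' x1 = Z' x1"
    and y: "y \<le> x1" "y \<le> x"
    and \<omega>: "\<And>x. \<omega> x = p0 + (p1 - p0) * indicator {x. x > x1} x"
  defines "S \<equiv> \<lambda>z. if z \<le> x1 then Z z else Y z"
  shows "set_integrable lborel {y..x} (\<lambda>z. \<omega> z *\<^sub>R (W (x - z) ** S z))"
    and "S x = W (x - y) + (LINT z:{y..x}|lborel. \<omega> z *\<^sub>R (W (x - z) ** S z))"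
proof -
  let ?U = "scale_sol G M Q" and ?U' = "scale_sol' G M Q"
  let ?f = "\<lambda>z. \<omega> z *\<^sub>R (W (x - z) ** S z)"
  define HZ where "HZ = (\<lambda>z. ?U (x - z) ** (D ** Z' z + M ** Z z) + ?U' (x - z) ** (D ** Z z))"
  define HY where "HY = (\<lambda>z. ?U (x - z) ** (D ** Y' z + M ** Y z) + ?U' (x - z) ** (D ** Y z))"
  let ?fZ = "\<lambda>z. p0 *\<^sub>R (?U (x - z) ** Z z)" and ?fY = "\<lambda>z. p1 *\<^sub>R (?U (x - z) ** Y z)"
  have hZ: "(?fZ has_integral HZ b - HZ a) {a..b}" if "a \<le> b" for a b
    unfolding HZ_def by (rule scale_sol_integral[OF GD(1) Z that])
  have hY: "(?fY has_integral HY b - HY a) {a..b}" if "a \<le> b" for a b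
    unfolding HY_def by (rule scale_sol_integral[OF GD(1) Y that])
  have cont: "continuous_on I (\<lambda>z. ?U (x - z))" "continuous_on I Z" "continuous_on I Y" for I
    using has_vector_derivative_reflect[OF scale_sol_deriv] Z(1) Y(1)
    by (auto intro!: continuous_at_imp_continuous_on has_vector_derivative_continuous)
  have cZ: "continuous_on I ?fZ" and cY: "continuous_on I ?fY" for I
    by (intro continuous_intros mm.continuous_on cont)+
  have fZ: "?f z = ?fZ z" if "z \<le> x1" "z \<le> x" for z
    using that W by (simp add: \<omega> S_def)
  have fY: "?f z = ?fY z" if "z > x1" "z \<le> x" for z
    using that W by (simp add: \<omega> S_def)
  \<comment> \<open>At the lower end \<open>Z y = 0\<close> and \<open>D ** Z' y = mat 1\<close>
    leave the inhomogeneous term. At the upper end the series vanishes and its derivative is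
    \<open>G\<close>, which leaves \<open>S x\<close>.\<close>
  have HZy: "HZ y = W (x - y)"
    using W[of "x - y"] y by (simp add: HZ_def init GD mm.zero_right)
  have *: "set_integrable lborel {y..x} ?f \<and> (?f has_integral S x - W (x - y)) {y..x}"
  proof (cases "x \<le> x1")
    case True
    have "set_integrable lborel {y..x} ?f"
      using borel_integrable_atLeastAtMost'[OF cZ, of y x] True
      by (subst set_integrable_cong[OF refl refl fZ]) auto
    moreover have "HZ x = S x"
      using True by (simp add: HZ_def S_def mm.zero_left matrix_mul_assoc GD)
    then have "(?f has_integral S x - W (x - y)) {y..x}"
      using hZ[OF y(2)] True unfolding HZy
      by (subst has_integral_cong[OF fZ]) auto
    ultimately show ?thesis by blast
  next
    case False
    have "set_integrable lborel {y..x1} ?f"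
      using borel_integrable_atLeastAtMost'[OF cZ, of y x1] False
      by (subst set_integrable_cong[OF refl refl fZ]) auto
    moreover have "set_integrable lborel {x1<..x} ?f"
    proof -
      have "set_integrable lborel {x1<..x} ?fY"
        by (rule set_integrable_subset[OF borel_integrable_atLeastAtMost'[OF cY, of x1 x]]) auto
      then show ?thesis by (subst set_integrable_cong[OF refl refl fY]) auto
    qed
    ultimately have "set_integrable lborel ({y..x1} \<union> {x1<..x}) ?f"
      by (intro set_integrable_Un) auto
    moreover have "{y..x1} \<union> {x1<..x} = {y..x}" using False y by auto
    moreover have "(?f has_integral (HZ x1 - HZ y) + (HY x - HY x1)) {y..x}"
    proof (rule has_integral_combine[of y x1 x])
      show "(?f has_integral HZ x1 - HZ y) {y..x1}"
        using hZ[OF y(1)] False by (subst has_integral_cong[OF fZ]) auto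
      \<comment> \<open>At \<open>x1\<close> itself \<open>\<omega>\<close> still has the value
        \<open>p0\<close>, so the integrand may differ from \<open>?fY\<close> at this one
        point.\<close>
      show "(?f has_integral HY x - HY x1) {x1..x}"
        by (rule has_integral_spike_finite[of "{x1}" _ _ ?fY]) (use hY[of x1 x] False fY in auto)
    qed (use y False in auto)
    moreover have "HZ x1 = HY x1" by (simp add: HZ_def HY_def match)
    moreover have "HY x = S x"
      using False by (simp add: HY_def S_def mm.zero_left matrix_mul_assoc GD)
    ultimately show ?thesis by (simp add: HZy)
  qed
  then show "set_integrable lborel {y..x} ?f" by simp
  show "S x = W (x - y) + (LINT z:{y..x}|lborel. ?f z)"
    using * set_borel_integral_eq_integral(2)[of "{y..x}" ?f] by (auto dest: integral_unique)
qed

text \<open>The factor of \<open>W p0 (x1 - y)\<close> has derivative 0 in \<open>x\<close> at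
  \<open>x1\<close>, so matching derivatives there rests on the \<open>W p1\<close> term alone. The
  right derivative of \<open>W p1\<close> at 0 is the inverse of the diagonal matrix, which forces
  the plus sign in front of that term. The range \<open>y \<le> x1\<close> keeps the arguments of
  \<open>W p0\<close> and of its derivative nonnegative.\<close>

theorem proposition5p3:
  fixes Q :: "real^'n^'n" and \<mu> \<sigma> :: "real^'n"
    and P :: "'n \<Rightarrow> 'w measure" and X :: "real \<Rightarrow> 'w \<Rightarrow> real" and J :: "real \<Rightarrow> 'w \<Rightarrow> 'n"
    and W :: "real \<Rightarrow> real \<Rightarrow> real^'n^'n" and \<Lambda>p \<Lambda>m :: "real \<Rightarrow> real^'n^'n"
    and V :: "real \<Rightarrow> real \<Rightarrow> real^'n^'n"
    and p0 p1 x1 :: real and \<omega> :: "real \<Rightarrow> real"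
  assumes "\<And>i. (\<sigma> $ i)\<^sup>2 > 0"
    and "mmbm Q \<mu> \<sigma> P X J"
    and "\<And>q. q \<ge> 0 \<Longrightarrow> scale_matrix Q \<mu> \<sigma> q (W q)"
    and "\<And>q. q > 0 \<Longrightarrow> first_passage_rate_matrix Q \<mu> \<sigma> P X J 1 q (\<Lambda>p q)"
    and "\<And>q. q > 0 \<Longrightarrow> first_passage_rate_matrix Q \<mu> \<sigma> P X J (-1) q (\<Lambda>m q)"
    and "p0 > 0" and "p1 > 0" and "x1 > 0"
    and "\<And>x. \<omega> x = p0 + (p1 - p0) * indicator {x. x > x1} x"
    and "omega_scale_matrix (W 0) \<omega> V"
  shows "(\<forall>x y. y < x \<and> x \<le> x1 \<longrightarrow> V x y = W p0 (x - y)) \<and>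
         (\<forall>x y. y \<le> x1 \<and> x1 < x \<longrightarrow>
            V x y =
              (mat_exp (- (x - x1) *\<^sub>R \<Lambda>p p1) ** matrix_inv (\<Lambda>p p1 + \<Lambda>m p1) ** \<Lambda>m p1
               + mat_exp ((x - x1) *\<^sub>R \<Lambda>m p1) ** matrix_inv (\<Lambda>p p1 + \<Lambda>m p1) ** \<Lambda>p p1)
                ** W p0 (x1 - y)
              + W p1 (x - x1) ** diag_mat (\<chi> i. (\<sigma> $ i)\<^sup>2 / 2) ** scale_deriv (W p0) (x1 - y))"
proof -
  define D where "D = diag_mat (\<chi> i. (\<sigma> $ i)\<^sup>2 / 2)"
  define G where "G = diag_mat (\<chi> i. 2 / (\<sigma> $ i)\<^sup>2)"
  define M where "M = diag_mat \<mu>"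
  have nz: "\<sigma> $ i \<noteq> 0" for i using assms(1)[of i] by auto
  have GD: "G ** D = mat 1" "D ** G = mat 1"
    by (simp_all add: G_def D_def diag_mat_mult nz diag_mat_1[symmetric])
  define U where "U q = scale_sol G M (Q - q *\<^sub>R mat 1)" for q
  define U' where "U' q = scale_sol' G M (Q - q *\<^sub>R mat 1)" for q
  define U'' where "U'' q = scale_sol'' G M (Q - q *\<^sub>R mat 1)" for q
  have W: "W q x = U q x" if "0 \<le> q" "0 \<le> x" for q x
    unfolding U_def M_def
    by (rule scale_matrix_eq_scale_sol[OF GD(1)[unfolded D_def] assms(3)[OF that(1)] that(2)])
  have dU: "(U q has_vector_derivative U' q x) (at x)" "(U' q has_vector_derivative U'' q x) (at x)" for q x
    unfolding U_def U'_def U''_def by (rule scale_sol_deriv scale_sol'_deriv)+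
  have odeU: "D ** U'' q x + M ** U' q x + (Q - q *\<^sub>R mat 1) ** U q x = 0" for q x
    unfolding U_def U'_def U''_def by (rule scale_sol_ode_left[OF GD(2)])
  have U0: "U q 0 = 0" "U' q 0 = G" for q by (simp_all add: U_def U'_def)
  have derivW: "scale_deriv (W p0) u = U' p0 u" if "0 \<le> u" for u
    unfolding scale_deriv_def
  proof (rule vector_derivative_within)
    \<comment> \<open>Every point of the half-line, 0 included, is a limit point of it, so the
      derivative within the half-line is unique.\<close>
    have "u islimpt {0..}"
      by (rule islimpt_subset[of u "{0..u + 1}"]) (use that in \<open>auto simp: islimpt_Icc\<close>)
    then show "at u within {0..} \<noteq> bot" by (simp add: trivial_limit_within)
    show "(W p0 has_vector_derivative U' p0 u) (at u within {0..})"
      by (rule has_vector_derivative_transform[OF _ _ has_vector_derivative_at_within[OF dU(1)]])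
        (use W[of p0] that \<open>p0 > 0\<close> in auto)
  qed
  have inv: "invertible (\<Lambda>p p1 + \<Lambda>m p1)"
    using assms(2,4,5) \<open>p1 > 0\<close>
    by (intro first_passage_sum_invertible[of Q P p1 \<mu> \<sigma> X J]) (auto simp: mmbm_def mmbm_from_def)
  define A where "A = (\<lambda>t. mat_exp (- t *\<^sub>R \<Lambda>p p1) ** matrix_inv (\<Lambda>p p1 + \<Lambda>m p1) ** \<Lambda>m p1
               + mat_exp (t *\<^sub>R \<Lambda>m p1) ** matrix_inv (\<Lambda>p p1 + \<Lambda>m p1) ** \<Lambda>p p1)"
  obtain A' A'' where dA: "\<And>t. (A has_vector_derivative A' t) (at t)"
      "\<And>t. (A' has_vector_derivative A'' t) (at t)"
    and odeA: "\<And>t. D ** A'' t + M ** A' t + (Q - p1 *\<^sub>R mat 1) ** A t = 0"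
    and A0: "A 0 = mat 1" "A' 0 = 0"
    using first_passage_fundamental_solution[OF assms(4,5)[OF \<open>p1 > 0\<close>] inv A_def, folded D_def M_def]
    by blast
  \<comment> \<open>The solution for \<open>p1\<close> with prescribed data at \<open>x1\<close>:
    \<open>A\<close> carries the value, and \<open>U p1\<close>, starting from 0 with slope
    \<open>G\<close>, carries the derivative once \<open>D\<close> has cancelled
    \<open>G\<close>.\<close>
  define Y where "Y y z = A (z - x1) ** U p0 (x1 - y) + U p1 (z - x1) ** (D ** U' p0 (x1 - y))" for y z
  define Y' where "Y' y z = A' (z - x1) ** U p0 (x1 - y) + U' p1 (z - x1) ** (D ** U' p0 (x1 - y))" for y z
  define Y'' where "Y'' y z = A'' (z - x1) ** U p0 (x1 - y) + U'' p1 (z - x1) ** (D ** U' p0 (x1 - y))" for y z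
  note left = bounded_linear.has_vector_derivative[OF mm.bounded_linear_left]
  have dY: "(Y y has_vector_derivative Y' y z) (at z)" "(Y' y has_vector_derivative Y'' y z) (at z)" for y z
    unfolding Y_def Y'_def Y''_def
    by (intro has_vector_derivative_add left has_vector_derivative_translate dA dU)+
  have odeY: "D ** Y'' y z + M ** Y' y z + (Q - p1 *\<^sub>R mat 1) ** Y y z = 0" for y z
  proof -
    have "D ** Y'' y z + M ** Y' y z + (Q - p1 *\<^sub>R mat 1) ** Y y z =
      (D ** A'' (z - x1) + M ** A' (z - x1) + (Q - p1 *\<^sub>R mat 1) ** A (z - x1)) ** U p0 (x1 - y) +
      (D ** U'' p1 (z - x1) + M ** U' p1 (z - x1) + (Q - p1 *\<^sub>R mat 1) ** U p1 (z - x1)) ** (D ** U' p0 (x1 - y))"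
      unfolding Y_def Y'_def Y''_def by (simp only: mm.add_left mm.add_right matrix_mul_assoc add_ac)
    then show ?thesis by (simp only: odeA odeU mm.zero_left add_0)
  qed
  define S where "S y z = (if z \<le> x1 then U p0 (z - y) else Y y z)" for y z
  have dZ: "((\<lambda>z. U p0 (z - y)) has_vector_derivative U' p0 (z - y)) (at z)"
      "((\<lambda>z. U' p0 (z - y)) has_vector_derivative U'' p0 (z - y)) (at z)" for y z
    by (intro has_vector_derivative_translate dU)+
  have W0: "0 \<le> t \<Longrightarrow> W 0 t = scale_sol G M Q t" for t using W[of 0 t] by (simp add: U_def)
  have match: "Y y x1 = U p0 (x1 - y)" "Y' y x1 = U' p0 (x1 - y)" for y
    by (simp_all add: Y_def Y'_def A0 U0 mm.zero_left matrix_mul_assoc GD)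
  \<comment> \<open>For fixed \<open>x\<close> and \<open>y\<close>, uniqueness is applied on the
    compact interval from \<open>y\<close> to \<open>x\<close>, where both pieces of
    \<open>S\<close> are continuous and hence bounded.\<close>
  have V: "V x y = S y x" if y: "y \<le> x1" "y \<le> x" for x y
  proof (rule omega_scale_matrix_unique[OF assms(10), where b = x and y = y and c = "p0 + p1"])
    have "compact ((\<lambda>t. U 0 t) ` {0..x - y})"
      using dU(1) by (intro compact_continuous_image continuous_at_imp_continuous_on ballI
          has_vector_derivative_continuous) auto
    moreover have "W 0 ` {0..x - y} = U 0 ` {0..x - y}" using W by (intro image_cong) auto
    ultimately show "bounded (W 0 ` {0..x - y})" by (simp add: compact_imp_bounded)
    have "compact ((\<lambda>z. U p0 (z - y)) ` {y..x})" "compact (Y y ` {y..x})"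
      using dZ(1) dY(1) by (auto intro!: compact_continuous_image continuous_at_imp_continuous_on
          has_vector_derivative_continuous)
    moreover have "S y ` {y..x} \<subseteq> (\<lambda>z. U p0 (z - y)) ` {y..x} \<union> Y y ` {y..x}"
      by (auto simp: S_def)
    ultimately show "bounded (S y ` {y..x})"
      by (meson bounded_Un bounded_subset compact_imp_bounded)
    show "\<bar>\<omega> z\<bar> \<le> p0 + p1" for z
      using assms(6,7) by (auto simp: assms(9) indicator_def)
    fix x' assume x': "y \<le> x'" "x' \<le> x"
    note * = renewal_two_pieces[OF GD W0 dZ odeU dY odeY _ _ match y(1) x'(1) assms(9), folded S_def]
    show "set_integrable lborel {y..x'} (\<lambda>z. \<omega> z *\<^sub>R (W 0 (x' - z) ** S y z))"
      "S y x' = W 0 (x' - y) + (LINT z:{y..x'}|lborel. \<omega> z *\<^sub>R (W 0 (x' - z) ** S y z))"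
      using * by (simp_all add: U0)
  qed (use y in auto)
  show ?thesis
  proof (intro conjI allI impI; elim conjE)
    fix x y assume "y < x" "x \<le> x1"
    then show "V x y = W p0 (x - y)"
      using V[of y x] W[of p0 "x - y"] \<open>p0 > 0\<close> by (simp add: S_def)
  next
    fix x y assume "y \<le> x1" "x1 < x"
    then show "V x y =
              (mat_exp (- (x - x1) *\<^sub>R \<Lambda>p p1) ** matrix_inv (\<Lambda>p p1 + \<Lambda>m p1) ** \<Lambda>m p1
               + mat_exp ((x - x1) *\<^sub>R \<Lambda>m p1) ** matrix_inv (\<Lambda>p p1 + \<Lambda>m p1) ** \<Lambda>p p1)
                ** W p0 (x1 - y)
              + W p1 (x - x1) ** diag_mat (\<chi> i. (\<sigma> $ i)\<^sup>2 / 2) ** scale_deriv (W p0) (x1 - y)"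
      using V[of y x] W[of p0 "x1 - y"] W[of p1 "x - x1"] derivW[of "x1 - y"] assms(6,7)
      by (simp add: S_def Y_def A_def D_def matrix_mul_assoc del: scaleR_minus_left)
  qed
qed

end
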